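(* Let $T\colon X\to X$ be a continuous transformation of a compact metric space and $\mathbb{E}$ an oriented circle bundle with base $X$. If two paths $\phi=(f_t)_{t\in[a,b]}$ and $\psi=(g_t)_{t\in[a,b]}$ in $Sk^+_{\mathbb{E},T}$ coincide in cohomology, that is, for every $t\in[a,b]$ there is $h_t\in Sk^+_{\mathbb{E},\mathrm{Id}_X}$ (with no continuity in $t$ required) conjugating $f_t$ and $g_t$, then their rotation numbers coincide: for all $x\in X$, if one of the rotation numbers $\rho(x,\phi)$ and $\rho(x,\psi)$ exists, then both do and they are equal.
   Context: $\mathbb{E}=\bigsqcup_{x\in X}\mathbb{E}_x$ is a continuous bundle of circles over $X$ with a continuous orientation of the fibers. For a continuous $S\colon X\to X$, $Sk^+_{\mathbb{E},S}$ is the set of continuous maps $f\colon\mathbb{E}\to\mathbb{E}$ that project to $S$ and map each fiber $\mathbb{E}_x$ to $\mathbb{E}_{Sx}$ by an orientation-preserving homeomorphism, with the topology of uniform convergence. Two elements $f,g\in Sk^+_{\mathbb{E},T}$ are cohomologous if they are conjugate by a homeomorphism in $Sk^+_{\mathbb{E},\mathrm{Id}_X}$. Endow $\mathbb{E}$ with a metric giving length $1$ to each circle. For a path $\gamma=(\gamma_t)_{t\in[a,b]}$ in a fiber $\mathbb{E}_x$, the winding number $w(\gamma)$ is the algebraic length of the oriented segment $[\widetilde\gamma_a,\widetilde\gamma_b]$, where $\widetilde\gamma$ is any lift of $\gamma$ to the universal cover of $\mathbb{E}_x$. For a path (continuous map from a compact interval) $\phi=(f_t)$ in $Sk^+_{\mathbb{E},T}$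 and $u\in\mathbb{E}$, $\phi u$ is the path $(f_tu)_t$ and $\phi^{(n)}$ is the path $(f_t^n)_t$ of $n$-th iterates. The rotation number of $\phi$ at $x\in X$ is, when the limit exists, $\rho(x,\phi)=\lim_{n\to+\infty}\frac1n w(\phi^{(n)}u)$ for any $u\in\mathbb{E}_x$; existence and value do not depend on $u\in\mathbb{E}_x$ nor on the metric. *)

theory Defs
  imports "HOL-Analysis.Analysis"
begin

(* The circle C is presented as R/Z: a universal cover is normalised so that its
   deck transformations are the integer translations. *)
definition circle_cover :: "'e::topological_space set \<Rightarrow> (real \<Rightarrow> 'e) \<Rightarrow> bool" where
  "circle_cover C c \<longleftrightarrow>
     covering_space UNIV c C \<and> (\<forall>s t. c s = c t \<longleftrightarrow> s - t \<in> \<int>)"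

definition same_orientation :: "(real \<Rightarrow> 'e) \<Rightarrow> (real \<Rightarrow> 'e) \<Rightarrow> bool" where
  "same_orientation c c' \<longleftrightarrow>
     (\<exists>F::real \<Rightarrow> real. continuous_on UNIV F \<and> strict_mono F \<and> c' = c \<circ> F)"

(* An orientation of the circle C is encoded as the class of its positively oriented
   universal covers. *)
definition circle_orientation :: "'e::topological_space set \<Rightarrow> (real \<Rightarrow> 'e) set \<Rightarrow> bool" where
  "circle_orientation C P \<longleftrightarrow>
     (\<exists>c. circle_cover C c \<and> P = {c'. circle_cover C c' \<and> same_orientation c c'})"

abbreviation fiber :: "('e \<Rightarrow> 'x) \<Rightarrow> 'x \<Rightarrow> 'e set" where
  "fiber p x \<equiv> p -` {x}"

abbreviation unit_circle :: "complex set" where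
  "unit_circle \<equiv> sphere 0 1"

(* The base X and the total space E are whole types, p is the projection and ori x is
   the orientation of the fiber over x.  Continuity of the orientation: near every point
   there is a local trivialisation k (with inverse h) sending the counterclockwise
   orientation of the unit circle to the orientation of each fiber. *)
definition oriented_circle_bundle ::
  "('e::topological_space \<Rightarrow> 'x::topological_space) \<Rightarrow> ('x \<Rightarrow> (real \<Rightarrow> 'e) set) \<Rightarrow> bool" where
  "oriented_circle_bundle p ori \<longleftrightarrow>
     continuous_on UNIV p \<and>
     (\<forall>x. circle_orientation (fiber p x) (ori x)) \<and>
     (\<forall>x. \<exists>U h k. open U \<and> x \<in> U \<and>
        homeomorphism (U \<times> unit_circle) (p -` U) h k \<and>
        (\<forall>y\<in>U. \<forall>z\<in>unit_circle. p (h (y, z)) = y) \<and>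
        (\<forall>y\<in>U. (\<lambda>t. h (y, cis (2 * pi * t))) \<in> ori y))"

(* Length of c on [s,t]: supremum over all subdivisions, given as sorted lists of points. *)
definition curve_length :: "(real \<Rightarrow> 'e::metric_space) \<Rightarrow> real \<Rightarrow> real \<Rightarrow> ennreal" where
  "curve_length c s t =
     (SUP ts\<in>{ts. sorted ts \<and> set ts \<subseteq> {s..t}}.
        \<Sum>i<length ts - 1. ennreal (dist (c (ts ! i)) (c (ts ! Suc i))))"

definition algebraic_length :: "(real \<Rightarrow> 'e::metric_space) \<Rightarrow> real \<Rightarrow> real \<Rightarrow> real" where
  "algebraic_length c s t =
     (if s \<le> t then enn2real (curve_length c s t) else - enn2real (curve_length c t s))"

definition unit_length_fibers :: "('x \<Rightarrow> (real \<Rightarrow> 'e::metric_space) set) \<Rightarrow> bool" where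
  "unit_length_fibers ori \<longleftrightarrow> (\<forall>x. \<forall>c\<in>ori x. curve_length c 0 1 = 1)"

(* Winding number of a path \<gamma> : [a,b] \<rightarrow> E contained in one fiber, necessarily
   the fiber over p (\<gamma> a).  The value does not depend on the positively oriented
   universal cover c nor on the lift g of \<gamma>. *)
definition path_winding ::
  "('e::metric_space \<Rightarrow> 'x) \<Rightarrow> ('x \<Rightarrow> (real \<Rightarrow> 'e) set) \<Rightarrow> real \<Rightarrow> real \<Rightarrow> (real \<Rightarrow> 'e) \<Rightarrow> real" where
  "path_winding p ori a b \<gamma> =
     (THE w. \<exists>c\<in>ori (p (\<gamma> a)). \<exists>g. continuous_on {a..b} g \<and>
        (\<forall>t\<in>{a..b}. c (g t) = \<gamma> t) \<and> w = algebraic_length c (g a) (g b))"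

definition Sk_plus ::
  "('e::topological_space \<Rightarrow> 'x) \<Rightarrow> ('x \<Rightarrow> (real \<Rightarrow> 'e) set) \<Rightarrow> ('x \<Rightarrow> 'x) \<Rightarrow> ('e \<Rightarrow> 'e) set" where
  "Sk_plus p ori S =
     {f. continuous_on UNIV f \<and> (\<forall>u. p (f u) = S (p u)) \<and>
         (\<forall>x. (\<exists>k. homeomorphism (fiber p x) (fiber p (S x)) f k) \<and>
              (\<forall>c\<in>ori x. f \<circ> c \<in> ori (S x)))}"

definition cohomologous ::
  "('e::topological_space \<Rightarrow> 'x) \<Rightarrow> ('x \<Rightarrow> (real \<Rightarrow> 'e) set) \<Rightarrow> ('e \<Rightarrow> 'e) \<Rightarrow> ('e \<Rightarrow> 'e) \<Rightarrow> bool" where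
  "cohomologous p ori f g \<longleftrightarrow>
     (\<exists>h\<in>Sk_plus p ori id. (\<exists>k. homeomorphism UNIV UNIV h k) \<and> h \<circ> f = g \<circ> h)"

definition Sk_path ::
  "('e::metric_space \<Rightarrow> 'x) \<Rightarrow> ('x \<Rightarrow> (real \<Rightarrow> 'e) set) \<Rightarrow> ('x \<Rightarrow> 'x) \<Rightarrow> real \<Rightarrow> real \<Rightarrow>
     (real \<Rightarrow> 'e \<Rightarrow> 'e) \<Rightarrow> bool" where
  "Sk_path p ori S a b \<phi> \<longleftrightarrow>
     (\<forall>t\<in>{a..b}. \<phi> t \<in> Sk_plus p ori S \<and> uniform_limit UNIV \<phi> (\<phi> t) (at t within {a..b}))"

definition has_rotation_number ::
  "('e::metric_space \<Rightarrow> 'x) \<Rightarrow> ('x \<Rightarrow> (real \<Rightarrow> 'e) set) \<Rightarrow> real \<Rightarrow> real \<Rightarrow>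
     (real \<Rightarrow> 'e \<Rightarrow> 'e) \<Rightarrow> 'x \<Rightarrow> real \<Rightarrow> bool" where
  "has_rotation_number p ori a b \<phi> x r \<longleftrightarrow>
     (\<forall>u\<in>fiber p x.
        (\<lambda>n. path_winding p ori a b (\<lambda>t. (\<phi> t ^^ n) u) / real n) \<longlonglongrightarrow> r)"

definition rotation_number ::
  "('e::metric_space \<Rightarrow> 'x) \<Rightarrow> ('x \<Rightarrow> (real \<Rightarrow> 'e) set) \<Rightarrow> real \<Rightarrow> real \<Rightarrow>
     (real \<Rightarrow> 'e \<Rightarrow> 'e) \<Rightarrow> 'x \<Rightarrow> real" where
  "rotation_number p ori a b \<phi> x = (THE r. has_rotation_number p ori a b \<phi> x r)"

end

(* Lifted to the real line, f_t and g_t become monotone maps commuting with x + 1, and w(phi^(n) u) is,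
   up to a bounded error, the displacement over [a,b] of the lifted orbit.  Let A_n(t) be the
   difference of the lifted orbits of f_t and g_t at time n, and D(t) the upper limit of
   |A_n(t) - A_n(a)| / n, truncated at 1.

   D is continuous: for |s - t| small, a block of N iterates contributes at most 2 to the displacement
   between s and t, so |A_n(s) - A_n(t)| <= 4 (n / N + 1).

   D takes countably many values: the h_t lie in a separable space, so they fall into countably many
   classes of nearby maps with a common modulus of continuity.  If h_s, h_t lie in one class and
   s, t are close, then the lifts H_s, H_t conjugate the lifted systems up to the same integer
   translations, these cancel, and A_n(s) - A_n(t) stays bounded.

   A continuous function on an interval with countable range is constant, so D(b) = D(a) = 0. *)
theory Submission
  imports Defs
begin


text \<open>If h_t varied continuously with t, its lifts would too, and the two displacements would
  differ by a bounded amount. Without continuity the obstruction is an integer: over each x, a lift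
  of h_t conjugates the lift of f_t to that of g_t up to a translation m_t(x), and A_n(t) is, up to
  terms governed by the lifts of h_t, the sum of m_t(T^i x) over i < n. Nothing controls m_t as t
  moves, except between parameters with uniformly close h_t: there the integers agree because they
  differ by less than 1. Dividing by n removes bounded errors, so D sees only the classes, while its
  continuity comes from f_t and g_t alone. The bundle need not be trivial, so lifts are chosen fiber
  by fiber without continuity in x. Every estimate must instead be uniform in x, which a finite set
  of charts over compact balls provides. A monotone map of degree one changes a displacement by at
  most 1, whatever its size, so errors add up under iteration but are never amplified.\<close>

section \<open>Continuous functions with values near the integers\<close>

text \<open>As e <= 1/2, the half-integers are never attained, and a connected image cannot jump
  over one. This turns closeness of circle-valued maps into closeness of their lifts up to a single
  integer.\<close>

lemma connected_near_integers:
  fixes g :: "'a::topological_space \<Rightarrow> real"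
  assumes "connected S" "continuous_on S g" "e \<le> 1/2"
    and near: "\<And>x. x \<in> S \<Longrightarrow> \<exists>m\<in>\<int>. \<bar>g x - m\<bar> < e"
  shows "\<exists>m::int. \<forall>x\<in>S. \<bar>g x - of_int m\<bar> < e"
proof (cases "S = {}")
  case False
  then obtain w where w: "w \<in> S" by blast
  have conn: "connected (g ` S)"
    using assms by (intro connected_continuous_image)
  have near_int: "\<exists>k::int. \<bar>g x - of_int k\<bar> < e" if "x \<in> S" for x
    using near[OF that] by (auto elim!: Ints_cases)
  have no_half: "of_int j + 1/2 \<notin> g ` S" for j :: int
  proof
    assume "of_int j + 1/2 \<in> g ` S"
    then obtain z where z: "z \<in> S" "g z = of_int j + 1/2" by auto
    obtain k :: int where k: "\<bar>g z - of_int k\<bar> < e" using near_int[OF z(1)] by blast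
    have "k \<le> j \<or> k \<ge> j + 1" by arith
    then have "real_of_int k \<le> of_int j \<or> real_of_int k \<ge> of_int j + 1" by linarith
    then show False using k z(2) \<open>e \<le> 1/2\<close> by linarith
  qed
  have le: "k \<le> m" if "x \<in> S" "y \<in> S" "\<bar>g x - of_int m\<bar> < e" "\<bar>g y - of_int k\<bar> < e" for x y and m k :: int
  proof (rule ccontr)
    assume "\<not> k \<le> m"
    then have "real_of_int k \<ge> of_int m + 1" by linarith
    then have "g x \<le> of_int m + 1/2" "of_int m + 1/2 \<le> g y"
      using that(3,4) \<open>e \<le> 1/2\<close> by linarith+
    then have "of_int m + 1/2 \<in> g ` S"
      using connectedD_interval[OF conn, of "g x" "g y"] that(1,2) by blast
    then show False using no_half by blast
  qed
  obtain m :: int where m: "\<bar>g w - of_int m\<bar> < e" using near_int[OF w] by blast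
  have "\<bar>g x - of_int m\<bar> < e" if x: "x \<in> S" for x
  proof -
    obtain k :: int where k: "\<bar>g x - of_int k\<bar> < e" using near_int[OF x] by blast
    have "k = m" using le[OF w x m k] le[OF x w k m] by simp
    then show ?thesis using k by simp
  qed
  then show ?thesis by blast
qed simp

lemma connected_integer_valued_constant:
  fixes g :: "'a::topological_space \<Rightarrow> real"
  assumes "connected S" "continuous_on S g" and int: "\<And>x. x \<in> S \<Longrightarrow> g x \<in> \<int>"
    and "x \<in> S" "y \<in> S"
  shows "g x = g y"
proof -
  have "\<exists>m::int. \<forall>x\<in>S. \<bar>g x - of_int m\<bar> < 1/2"
  proof (rule connected_near_integers)
    show "\<exists>m\<in>\<int>. \<bar>g z - m\<bar> < 1/2" if "z \<in> S" for z
      using int[OF that] by (intro bexI[of _ "g z"]) auto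
  qed (use assms in auto)
  then obtain m :: int where "\<bar>g x - of_int m\<bar> < 1/2" "\<bar>g y - of_int m\<bar> < 1/2"
    using assms by blast
  then have "\<bar>g x - g y\<bar> < 1" by linarith
  then show ?thesis
    using Ints_nonzero_abs_less1[of "g x - g y"] int assms(4,5) by auto
qed

section \<open>Lengths of curves\<close>

text \<open>Recursive form of the sum in \<open>curve_length\<close>, so that refining and joining
  subdivisions become inductions on lists.\<close>

fun chain_length :: "(real \<Rightarrow> 'e::metric_space) \<Rightarrow> real list \<Rightarrow> ennreal" where
  "chain_length c (x # y # zs) = ennreal (dist (c x) (c y)) + chain_length c (y # zs)"
| "chain_length c _ = 0"

lemma chain_length_eq_sum:
  "chain_length c ts = (\<Sum>i<length ts - 1. ennreal (dist (c (ts ! i)) (c (ts ! Suc i))))"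
  by (induction c ts rule: chain_length.induct) (auto simp: sum.lessThan_Suc_shift simp del: sum.lessThan_Suc)

lemma curve_length_eq_SUP_chain_length:
  "curve_length c s t = (SUP ts\<in>{ts. sorted ts \<and> set ts \<subseteq> {s..t}}. chain_length c ts)"
  by (simp add: curve_length_def chain_length_eq_sum)

lemma chain_length_append_pivot:
  "chain_length c (xs @ x # ys) = chain_length c (xs @ [x]) + chain_length c (x # ys)"
  by (induction c xs rule: chain_length.induct) (auto simp: add.assoc)

lemma chain_length_Cons_ge: "chain_length c xs \<le> chain_length c (x # xs)"
  by (cases xs) auto

lemma chain_length_append_ge:
  "chain_length c xs + chain_length c ys \<le> chain_length c (xs @ ys)"
proof (induction c xs rule: chain_length.induct)
  case ("2_2" c v)
  show ?case using chain_length_Cons_ge[of c ys v] by simp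
qed (auto simp: add.assoc intro: add_left_mono)

lemma chain_length_insert_ge:
  "chain_length c (xs @ ys) \<le> chain_length c (xs @ x # ys)"
proof (induction c xs rule: chain_length.induct)
  case ("2_1" c)
  show ?case using chain_length_Cons_ge[of c ys x] by simp
next
  case ("2_2" c v)
  show ?case
  proof (cases ys)
    case (Cons y ys')
    have "ennreal (dist (c v) (c y)) \<le> ennreal (dist (c v) (c x)) + ennreal (dist (c x) (c y))"
      by (simp add: dist_triangle flip: ennreal_plus)
    then show ?thesis by (simp add: Cons add.assoc[symmetric] add_right_mono)
  qed simp
qed (auto intro: add_left_mono)

text \<open>Inserting t into a subdivision of [s,r] cannot decrease its sum, by the triangle
  inequality, and then the sum splits at t. Conversely, joining subdivisions of the two halves adds
  at most one nonnegative link.\<close>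

lemma curve_length_add:
  assumes "s \<le> t" "t \<le> r"
  shows "curve_length c s r = curve_length c s t + curve_length c t r"
proof (rule antisym)
  show "curve_length c s r \<le> curve_length c s t + curve_length c t r"
    unfolding curve_length_eq_SUP_chain_length[of c s r]
  proof (rule SUP_least, clarify)
    fix ts assume ts: "sorted ts" "set ts \<subseteq> {s..r}"
    define xs ys where "xs = filter (\<lambda>u. u \<le> t) ts" and "ys = filter (\<lambda>u. \<not> u \<le> t) ts"
    have "xs @ ys = ts"
      unfolding xs_def ys_def using ts(1)
    proof (induction ts)
      case (Cons u us)
      show ?case
      proof (cases "u \<le> t")
        case False
        with Cons.prems have "filter (\<lambda>u. u \<le> t) us = []" "filter (\<lambda>u. \<not> u \<le> t) us = us"
          by (auto simp: filter_empty_conv filter_id_conv)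
        then show ?thesis using False by simp
      qed (use Cons in auto)
    qed simp
    then have "chain_length c ts \<le> chain_length c (xs @ t # ys)"
      using chain_length_insert_ge[of c xs ys t] by simp
    also have "\<dots> = chain_length c (xs @ [t]) + chain_length c (t # ys)"
      by (rule chain_length_append_pivot)
    also have "\<dots> \<le> curve_length c s t + curve_length c t r"
      unfolding curve_length_eq_SUP_chain_length using ts assms
      by (intro add_mono SUP_upper) (auto simp: xs_def ys_def sorted_append sorted_wrt_filter)
    finally show "chain_length c ts \<le> curve_length c s t + curve_length c t r" .
  qed
  have ne: "{ts. sorted ts \<and> set ts \<subseteq> {u..v}} \<noteq> {}" for u v :: real
    by (auto intro: exI[of _ "[]"])
  show "curve_length c s t + curve_length c t r \<le> curve_length c s r"
    unfolding curve_length_eq_SUP_chain_length[of c s t] curve_length_eq_SUP_chain_length[of c t r]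
      ennreal_SUP_add_left[OF ne, symmetric]
  proof (rule SUP_least)
    fix xs assume xs: "xs \<in> {ts. sorted ts \<and> set ts \<subseteq> {s..t}}"
    show "chain_length c xs + (SUP ys\<in>{ts. sorted ts \<and> set ts \<subseteq> {t..r}}. chain_length c ys)
        \<le> curve_length c s r"
      unfolding ennreal_SUP_add_right[OF ne]
    proof (rule SUP_least)
      fix ys assume ys: "ys \<in> {ts. sorted ts \<and> set ts \<subseteq> {t..r}}"
      have "chain_length c xs + chain_length c ys \<le> chain_length c (xs @ ys)"
        by (rule chain_length_append_ge)
      also have "\<dots> \<le> curve_length c s r"
        unfolding curve_length_eq_SUP_chain_length using xs ys assms
        by (intro SUP_upper) (force simp: sorted_append)
      finally show "chain_length c xs + chain_length c ys \<le> curve_length c s r" .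
    qed
  qed
qed

lemma chain_length_map: "chain_length c (map F ts) = chain_length (c \<circ> F) ts"
  by (induction c ts rule: chain_length.induct) auto

text \<open>F transports subdivisions in both directions: by the intermediate value theorem every
  point of [F s, F t] is a value of F.\<close>

lemma curve_length_reparametrization:
  assumes "continuous_on UNIV F" "strict_mono (F :: real \<Rightarrow> real)" "s \<le> t"
  shows "curve_length (c \<circ> F) s t = curve_length c (F s) (F t)"
proof (rule antisym)
  have mono: "F u \<le> F v \<longleftrightarrow> u \<le> v" for u v
    using assms(2) by (simp add: strict_mono_less_eq)
  show "curve_length (c \<circ> F) s t \<le> curve_length c (F s) (F t)"
    unfolding curve_length_eq_SUP_chain_length
    by (rule SUP_mono) (force simp: mono sorted_map chain_length_map[symmetric] image_subset_iff
        intro: exI[of _ "map F _"])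
  show "curve_length c (F s) (F t) \<le> curve_length (c \<circ> F) s t"
    unfolding curve_length_eq_SUP_chain_length
  proof (rule SUP_mono, clarify)
    fix us assume us: "sorted us" "set us \<subseteq> {F s..F t}"
    have "\<exists>v. F v = u" if "u \<in> set us" for u
      using IVT'[of F s u t] us(2) that assms continuous_on_subset[OF assms(1)] by force
    then obtain ts where ts: "us = map F ts"
      by (metis ex_map_conv)
    show "\<exists>ts\<in>{ts. sorted ts \<and> set ts \<subseteq> {s..t}}. chain_length c us \<le> chain_length (c \<circ> F) ts"
      using us by (intro bexI[of _ ts]) (auto simp: ts mono sorted_map chain_length_map image_subset_iff)
  qed
qed

lemma algebraic_length_reparametrization:
  assumes "continuous_on UNIV F" "strict_mono (F :: real \<Rightarrow> real)"
  shows "algebraic_length (c \<circ> F) s t = algebraic_length c (F s) (F t)"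
  using assms curve_length_reparametrization[OF assms, of s t c]
    curve_length_reparametrization[OF assms, of t s c]
  by (simp add: algebraic_length_def strict_mono_less_eq)

lemma curve_length_int:
  assumes per: "\<And>u (m::int). c (u + of_int m) = c u" and one: "curve_length c 0 1 = 1"
  shows "curve_length c (of_int i) (of_int i + of_nat n) = of_nat n"
proof -
  have unit: "curve_length c (of_int j) (of_int j + 1) = 1" for j :: int
  proof -
    have "curve_length (c \<circ> (\<lambda>u. u + of_int j)) 0 1 = curve_length c (0 + of_int j) (1 + of_int j)"
      by (rule curve_length_reparametrization) (auto simp: strict_mono_def intro!: continuous_intros)
    moreover have "c \<circ> (\<lambda>u. u + of_int j) = c"
      using per by auto
    ultimately show ?thesis using one by (simp add: add.commute)
  qed
  show ?thesis
  proof (induction n)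
    case 0
    \<comment> \<open>The degenerate interval has length 0 because additivity lets the finite length
      1 be cancelled.\<close>
    have "curve_length c (of_int i) (of_int i) + 1 = 1"
      using curve_length_add[of "of_int i" "of_int i" "of_int i + 1" c] unit[of i] by simp
    then have "curve_length c (of_int i) (of_int i) = 0"
      using ennreal_add_left_cancel[of 1 "curve_length c (of_int i) (of_int i)" 0]
      by (simp add: add.commute)
    then show ?case by simp
  next
    case (Suc n)
    have "curve_length c (of_int i) (of_int i + real (Suc n))
        = curve_length c (of_int i) (of_int i + real n)
          + curve_length c (of_int i + real n) (of_int i + real (Suc n))"
      by (rule curve_length_add) auto
    also have "curve_length c (of_int i + real n) (of_int i + real (Suc n)) = 1"
      using unit[of "i + int n"] by (simp add: algebra_simps)
    finally show ?case using Suc by (simp add: add.commute)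
  qed
qed

lemma curve_length_mono:
  assumes "s \<le> s'" "t' \<le> t"
  shows "curve_length c s' t' \<le> curve_length c s t"
  unfolding curve_length_eq_SUP_chain_length using assms
  by (intro SUP_subset_mono) auto

text \<open>The parameter of c need not be arc length; length and parameter are sure to agree only
  between integers. Rounding both endpoints outwards, then inwards, costs less than 2 on either
  side.\<close>

lemma algebraic_length_approx:
  assumes per: "\<And>u (m::int). c (u + of_int m) = c u" and one: "curve_length c 0 1 = 1"
  shows "\<bar>algebraic_length c s t - (t - s)\<bar> \<le> 2"
proof -
  have main: "\<bar>enn2real (curve_length c s t) - (t - s)\<bar> \<le> 2" if "s \<le> t" for s t
  proof -
    define n where "n = nat (\<lceil>t\<rceil> - \<lfloor>s\<rfloor>)"
    have n: "of_int \<lfloor>s\<rfloor> + real n = of_int \<lceil>t\<rceil>" 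
    proof -
      have "\<lfloor>s\<rfloor> \<le> \<lceil>t\<rceil>" using that by linarith
      then show ?thesis by (simp add: n_def)
    qed
    have le: "curve_length c s t \<le> of_nat n"
      using curve_length_mono[of "of_int \<lfloor>s\<rfloor>" s t "of_int \<lceil>t\<rceil>" c]
        curve_length_int[OF per one, of "\<lfloor>s\<rfloor>" n] n by simp
    \<comment> \<open>Finiteness matters because \<open>enn2real\<close> sends infinity to 0; the
      lower bound below needs it for monotonicity.\<close>
    then have fin: "curve_length c s t < \<infinity>"
      by (metis ennreal_of_nat_neq_top infinity_ennreal_def less_top neq_top_trans)
    have up: "enn2real (curve_length c s t) \<le> t - s + 2"
    proof -
      have "enn2real (curve_length c s t) \<le> real n"
        using enn2real_mono[OF le] by (simp add: enn2real_of_nat ennreal_of_nat_eq_real_of_nat)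
      then show ?thesis using n by linarith
    qed
    have "t - s - 2 \<le> enn2real (curve_length c s t)"
    proof (cases "\<lceil>s\<rceil> \<le> \<lfloor>t\<rfloor>")
      case False
      then show ?thesis using enn2real_nonneg[of "curve_length c s t"] by linarith
    next
      case True
      define m where "m = nat (\<lfloor>t\<rfloor> - \<lceil>s\<rceil>)"
      have m: "of_int \<lceil>s\<rceil> + real m = of_int \<lfloor>t\<rfloor>" using True unfolding m_def by simp
      have "of_nat m \<le> curve_length c s t"
        using curve_length_mono[of s "of_int \<lceil>s\<rceil>" "of_int \<lfloor>t\<rfloor>" t c]
          curve_length_int[OF per one, of "\<lceil>s\<rceil>" m] m by simp
      then have "real m \<le> enn2real (curve_length c s t)"
        using enn2real_mono[of "of_nat m" "curve_length c s t"] fin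
        by (simp add: ennreal_of_nat_eq_real_of_nat)
      then show ?thesis using m by linarith
    qed
    with up show ?thesis by linarith
  qed
  show ?thesis
    using main[of s t] main[of t s] by (auto simp: algebraic_length_def abs_if split: if_splits)
qed


section \<open>Orientations and winding numbers\<close>

definition monotone_degree_one :: "(real \<Rightarrow> real) \<Rightarrow> bool" where
  "monotone_degree_one F \<longleftrightarrow> mono F \<and> (\<forall>y. F (y + 1) = F y + 1)"

lemma circle_cover_eq_iff: "circle_cover C c \<Longrightarrow> c s = c t \<longleftrightarrow> s - t \<in> \<int>"
  by (simp add: circle_cover_def)

lemma circle_cover_add_int: "circle_cover C c \<Longrightarrow> c (s + of_int m) = c s"
  by (simp add: circle_cover_eq_iff)

lemma circle_cover_range: "circle_cover C c \<Longrightarrow> range c = C"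
  by (auto simp: circle_cover_def covering_space_def)

lemma circle_cover_continuous: "circle_cover C c \<Longrightarrow> continuous_on UNIV c"
  by (auto simp: circle_cover_def covering_space_def)

lemma circle_orientation_factor:
  assumes "circle_orientation C P"
  shows "\<exists>c0. circle_cover C c0 \<and>
    (\<forall>c\<in>P. \<exists>F. continuous_on UNIV F \<and> strict_mono F \<and> c = c0 \<circ> F)"
  using assms by (auto simp: circle_orientation_def same_orientation_def)

lemma circle_orientation_cover:
  assumes "circle_orientation C P" "c \<in> P"
  shows "circle_cover C c"
  using assms by (auto simp: circle_orientation_def)

lemma circle_cover_lifts_differ_by_integer:
  fixes f g :: "'a::topological_space \<Rightarrow> real"
  assumes "circle_cover C c" "connected S" "continuous_on S f" "continuous_on S g"
    and eq: "\<And>x. x \<in> S \<Longrightarrow> c (f x) = c (g x)"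
  obtains m :: int where "\<And>x. x \<in> S \<Longrightarrow> f x = g x + of_int m"
proof (cases "S = {}")
  case False
  then obtain w where w: "w \<in> S" by blast
  have int: "f x - g x \<in> \<int>" if "x \<in> S" for x
    using eq[OF that] assms(1) by (simp add: circle_cover_eq_iff)
  from int[OF w] obtain m :: int where m: "f w - g w = of_int m"
    by (auto elim: Ints_cases)
  have "f x = g x + of_int m" if "x \<in> S" for x
    using connected_integer_valued_constant[of S "\<lambda>x. f x - g x" x w] assms that int w m
    by (simp add: continuous_intros)
  then show ?thesis using that by blast
qed (use that in auto)

text \<open>Through the reference cover \<open>c0\<close>, the maps F1 o F and \<open>F2\<close>
  lift the same map, so they differ by a constant integer and F inherits strict monotonicity. Then F
  (y + 1) - F y is a positive integer; if it were 2 or more, \<open>c'\<close> would repeat a value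
  in less than one period.\<close>

lemma oriented_transition_degree_one:
  assumes ori: "circle_orientation C P" and "c \<in> P" "c' \<in> P"
    and F: "continuous_on UNIV F" "c' = c \<circ> F"
  shows "monotone_degree_one F"
proof -
  obtain c0 F1 F2 where c0: "circle_cover C c0"
    and F1: "continuous_on UNIV F1" "strict_mono F1" "c = c0 \<circ> F1"
    and F2: "continuous_on UNIV F2" "strict_mono F2" "c' = c0 \<circ> F2"
    using circle_orientation_factor[OF ori] assms(2,3) by metis
  have contF1F: "continuous_on UNIV (\<lambda>y. F1 (F y))"
    using continuous_on_compose2[OF F1(1) F(1)] by simp
  have "c0 (F2 y) = c0 (F1 (F y))" for y
    using F F1(3) F2(3) by (metis comp_apply)
  then obtain m :: int where m: "\<And>y. F2 y = F1 (F y) + of_int m"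
    using circle_cover_lifts_differ_by_integer[OF c0 connected_UNIV F2(1) contF1F] by auto
  have sm: "strict_mono F"
  proof (rule strict_monoI)
    fix y z :: real assume "y < z"
    then have "F1 (F y) < F1 (F z)"
      using strict_monoD[OF F2(2), of y z] m[of y] m[of z] by simp
    then show "F y < F z" using F1(2) by (simp add: strict_mono_less)
  qed
  have c: "circle_cover C c" and c': "circle_cover C c'"
    using circle_orientation_cover[OF ori] assms(2,3) by auto
  have "F (y + 1) = F y + 1" for y
  proof -
    have "c (F (y + 1)) = c (F y)"
      using circle_cover_eq_iff[OF c', of "y + 1" y] F(2) by simp
    then obtain k :: int where k: "F (y + 1) - F y = of_int k"
      using circle_cover_eq_iff[OF c] by (auto elim: Ints_cases)
    have "F y < F (y + 1)" using sm by (simp add: strict_mono_less)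
    then have "k \<ge> 1" using k by linarith
    have "\<not> k \<ge> 2"
    proof
      assume "k \<ge> 2"
      then have "F y + 1 \<le> F (y + 1)" using k by linarith
      then obtain z where z: "y \<le> z" "z \<le> y + 1" "F z = F y + 1"
        using IVT'[of F y "F y + 1" "y + 1"] continuous_on_subset[OF F(1)] by auto
      have "c' z = c' y"
        using F(2) z(3) circle_cover_eq_iff[OF c, of "F y + 1" "F y"] by simp
      then have int: "z - y \<in> \<int>" using circle_cover_eq_iff[OF c'] by simp
      have "z \<noteq> y" using z(3) by auto
      moreover have "z \<noteq> y + 1" using z(3) k \<open>k \<ge> 2\<close> by auto
      ultimately show False
        using z int Ints_nonzero_abs_less1[of "z - y"] by auto
    qed
    with \<open>k \<ge> 1\<close> have "k = 1" by simp
    with k show ?thesis by simp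
  qed
  with sm show ?thesis
    by (simp add: monotone_degree_one_def strict_mono_mono)
qed

text \<open>The description in \<open>path_winding\<close> is legitimate because every pair of a
  cover and a lift can be carried to one reference cover \<open>c0\<close> without changing the
  algebraic length; there, lifts differ by an integer translation, which preserves length.\<close>

lemma path_winding_approx:
  assumes ori: "circle_orientation (fiber p x) (ori x)"
    and unit: "\<And>c. c \<in> ori x \<Longrightarrow> curve_length c 0 1 = 1"
    and "p (\<gamma> a) = x" "a \<le> b" and c: "c \<in> ori x"
    and g: "continuous_on {a..b} g" "\<And>t. t \<in> {a..b} \<Longrightarrow> c (g t) = \<gamma> t"
  shows "\<bar>path_winding p ori a b \<gamma> - (g b - g a)\<bar> \<le> 2"
proof -
  from circle_orientation_factor[OF ori] obtain c0 where "circle_cover (fiber p x) c0 \<and>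
    (\<forall>c\<in>ori x. \<exists>F. continuous_on UNIV F \<and> strict_mono F \<and> c = c0 \<circ> F)" ..
  then have c0: "circle_cover (fiber p x) c0"
    and factor: "\<forall>c\<in>ori x. \<exists>F. continuous_on UNIV F \<and> strict_mono F \<and> c = c0 \<circ> F"
    by auto
  have base: "\<exists>h. continuous_on {a..b} h \<and> (\<forall>t\<in>{a..b}. c0 (h t) = \<gamma> t) \<and>
      algebraic_length c' (g' a) (g' b) = algebraic_length c0 (h a) (h b)"
    if "c' \<in> ori x" "continuous_on {a..b} g'" "\<forall>t\<in>{a..b}. c' (g' t) = \<gamma> t" for c' g'
  proof -
    from bspec[OF factor that(1)]
    obtain F where F: "continuous_on UNIV F" "strict_mono F" "c' = c0 \<circ> F"
      by (elim exE conjE)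
    show ?thesis
    proof (intro exI conjI)
      show "continuous_on {a..b} (\<lambda>t. F (g' t))"
        using continuous_on_compose2[OF F(1) that(2)] by simp
      show "algebraic_length c' (g' a) (g' b) = algebraic_length c0 (F (g' a)) (F (g' b))"
        unfolding F(3) by (rule algebraic_length_reparametrization[OF F(1,2)])
    qed (use F that in auto)
  qed
  have unique: "algebraic_length c' (g' a) (g' b) = algebraic_length c (g a) (g b)"
    if c': "c' \<in> ori x" "continuous_on {a..b} g'" "\<forall>t\<in>{a..b}. c' (g' t) = \<gamma> t" for c' g'
  proof -
    obtain h where h: "continuous_on {a..b} h" "\<forall>t\<in>{a..b}. c0 (h t) = \<gamma> t"
      "algebraic_length c (g a) (g b) = algebraic_length c0 (h a) (h b)"
      using base[OF c g(1)] g(2) by blast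
    obtain h' where h': "continuous_on {a..b} h'" "\<forall>t\<in>{a..b}. c0 (h' t) = \<gamma> t"
      "algebraic_length c' (g' a) (g' b) = algebraic_length c0 (h' a) (h' b)"
      using base[OF c'] by blast
    obtain m :: int where m: "\<And>t. t \<in> {a..b} \<Longrightarrow> h' t = h t + of_int m"
      using circle_cover_lifts_differ_by_integer[OF c0 _ h'(1) h(1)] h(2) h'(2) by auto
    have "algebraic_length (c0 \<circ> (\<lambda>u. u + of_int m)) (h a) (h b) =
        algebraic_length c0 (h a + of_int m) (h b + of_int m)"
      by (rule algebraic_length_reparametrization)
        (auto simp: strict_mono_def intro!: continuous_intros)
    moreover have "c0 \<circ> (\<lambda>u. u + of_int m) = c0"
      using circle_cover_add_int[OF c0] by auto
    ultimately show ?thesis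
      using h(3) h'(3) m \<open>a \<le> b\<close> by simp
  qed
  have "path_winding p ori a b \<gamma> = algebraic_length c (g a) (g b)"
    unfolding path_winding_def
  proof (rule the_equality)
    show "\<exists>c'\<in>ori (p (\<gamma> a)). \<exists>g'. continuous_on {a..b} g' \<and> (\<forall>t\<in>{a..b}. c' (g' t) = \<gamma> t) \<and>
        algebraic_length c (g a) (g b) = algebraic_length c' (g' a) (g' b)"
      using assms by blast
  next
    fix w
    assume "\<exists>c'\<in>ori (p (\<gamma> a)). \<exists>g'. continuous_on {a..b} g' \<and> (\<forall>t\<in>{a..b}. c' (g' t) = \<gamma> t) \<and>
        w = algebraic_length c' (g' a) (g' b)"
    then show "w = algebraic_length c (g a) (g b)"
      using unique \<open>p (\<gamma> a) = x\<close> by blast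
  qed
  moreover have "\<bar>algebraic_length c (g a) (g b) - (g b - g a)\<bar> \<le> 2"
    using circle_cover_add_int[OF circle_orientation_cover[OF ori c]] unit[OF c]
    by (rule algebraic_length_approx)
  ultimately show ?thesis by simp
qed


section \<open>Orbits of families of degree one maps\<close>

lemma monotone_degree_one_mono: "monotone_degree_one F \<Longrightarrow> y \<le> z \<Longrightarrow> F y \<le> F z"
  by (simp add: monotone_degree_one_def monoD)

lemma monotone_degree_one_add_int:
  assumes "monotone_degree_one F"
  shows "F (y + of_int m) = F y + of_int m"
proof -
  have nat: "F (z + real n) = F z + real n" for z n
  proof (induction n)
    case (Suc n)
    have "F ((z + real n) + 1) = F (z + real n) + 1"
      using assms by (simp add: monotone_degree_one_def)
    then show ?case using Suc by (simp add: algebra_simps)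
  qed simp
  show ?thesis
  proof (cases "m \<ge> 0")
    case True
    then show ?thesis using nat[of y "nat m"] by simp
  next
    case False
    then show ?thesis using nat[of "y + of_int m" "nat (- m)"] by simp
  qed
qed

text \<open>If m is the integer part of y - z, then both y - z and F y - F z lie in
  [m, m + 1].\<close>

lemma monotone_degree_one_displacement:
  assumes "monotone_degree_one F"
  shows "\<bar>(F y - F z) - (y - z)\<bar> \<le> 1"
proof -
  define m where "m = \<lfloor>y - z\<rfloor>"
  have m: "z + of_int m \<le> y" "y \<le> z + of_int (m + 1)"
    unfolding m_def by linarith+
  have "F z + of_int m \<le> F y" "F y \<le> F z + of_int (m + 1)"
    using m monotone_degree_one_mono[OF assms]
    unfolding monotone_degree_one_add_int[OF assms, symmetric] by blast+
  then show ?thesis using m by (simp add: abs_le_iff)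
qed

text \<open>The map changes with time: step n will be the lift from the fiber over T^n x to the next
  one. The parameter t stays fixed along the orbit.\<close>

primrec orbit :: "(nat \<Rightarrow> real \<Rightarrow> real \<Rightarrow> real) \<Rightarrow> real \<Rightarrow> real \<Rightarrow> nat \<Rightarrow> real" where
  "orbit F y t 0 = y"
| "orbit F y t (Suc n) = F n t (orbit F y t n)"

lemma orbit_add: "orbit F y t (k + n) = orbit (\<lambda>i. F (k + i)) (orbit F y t k) t n"
  by (induction n) auto

lemma monotone_degree_one_orbit:
  assumes "\<And>i. monotone_degree_one (F i t)"
  shows "monotone_degree_one (\<lambda>y. orbit F y t n)"
  using assms by (induction n) (auto simp: monotone_degree_one_def mono_def)

text \<open>One modulus for all times i, so that a single choice of d serves every block of iterates
  wherever it starts.\<close>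

definition uniformly_equicontinuous ::
  "real set \<Rightarrow> (nat \<Rightarrow> real \<Rightarrow> real \<Rightarrow> real) \<Rightarrow> bool" where
  "uniformly_equicontinuous A F \<longleftrightarrow>
     (\<forall>e>0. \<exists>d>0. \<forall>i. \<forall>s\<in>A. \<forall>t\<in>A. \<forall>y z.
        \<bar>s - t\<bar> < d \<longrightarrow> \<bar>y - z\<bar> < d \<longrightarrow> \<bar>F i s y - F i t z\<bar> < e)"

lemma uniformly_equicontinuousD:
  assumes "uniformly_equicontinuous A F" "e > 0"
  obtains d where "d > 0" "\<And>i s t y z. s \<in> A \<Longrightarrow> t \<in> A \<Longrightarrow> \<bar>s - t\<bar> < d \<Longrightarrow> \<bar>y - z\<bar> < d \<Longrightarrow>
    \<bar>F i s y - F i t z\<bar> < e"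
  using assms unfolding uniformly_equicontinuous_def by meson

lemma uniformly_equicontinuous_orbits:
  assumes F: "uniformly_equicontinuous A F" and "e > 0"
  shows "\<exists>d>0. \<forall>n\<le>N. \<forall>k. \<forall>s\<in>A. \<forall>t\<in>A. \<forall>y z. \<bar>s - t\<bar> < d \<longrightarrow> \<bar>y - z\<bar> < d \<longrightarrow>
    \<bar>orbit (\<lambda>i. F (k + i)) y s n - orbit (\<lambda>i. F (k + i)) z t n\<bar> < e"
  using \<open>e > 0\<close>
proof (induction N arbitrary: e)
  case 0
  then show ?case by (intro exI[of _ e]) auto
next
  case (Suc N)
  obtain d0 where d0: "d0 > 0" "\<And>i s t y z. s \<in> A \<Longrightarrow> t \<in> A \<Longrightarrow> \<bar>s - t\<bar> < d0 \<Longrightarrow> \<bar>y - z\<bar> < d0 \<Longrightarrow>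
    \<bar>F i s y - F i t z\<bar> < e"
    using uniformly_equicontinuousD[OF F \<open>e > 0\<close>] by metis
  \<comment> \<open>The bound \<open>d0\<close> prepares the last iterate, the bound e settles the
    shorter orbits.\<close>
  obtain d1 where d1: "d1 > 0" "\<And>n k s t y z. n \<le> N \<Longrightarrow> s \<in> A \<Longrightarrow> t \<in> A \<Longrightarrow> \<bar>s - t\<bar> < d1 \<Longrightarrow> \<bar>y - z\<bar> < d1 \<Longrightarrow>
    \<bar>orbit (\<lambda>i. F (k + i)) y s n - orbit (\<lambda>i. F (k + i)) z t n\<bar> < min d0 e"
    using Suc.IH[of "min d0 e"] Suc.prems d0(1) by (metis min_less_iff_conj)
  show ?case
  proof (intro exI conjI allI ballI impI)
    show "min d0 d1 > 0" using d0 d1 by simp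
    fix n k s t y z
    assume "n \<le> Suc N" and st: "s \<in> A" "t \<in> A" "\<bar>s - t\<bar> < min d0 d1" "\<bar>y - z\<bar> < min d0 d1"
    then consider "n \<le> N" | "n = Suc N" by linarith
    then show "\<bar>orbit (\<lambda>i. F (k + i)) y s n - orbit (\<lambda>i. F (k + i)) z t n\<bar> < e"
    proof cases
      case 1
      then show ?thesis using d1(2)[of n s t y z k] st by simp
    next
      case 2
      then show ?thesis using d1(2)[of N s t y z k] st by (simp add: d0(2))
    qed
  qed
qed

text \<open>Cutting an orbit of length \<open>n\<close> into blocks of length \<open>N\<close>, the parameter may be moved so little
  that each block contributes at most 2 to the displacement.\<close>

lemma orbit_displacement_parameter:
  assumes F: "uniformly_equicontinuous A F" and "N > 0"
    and deg: "\<And>i t. t \<in> A \<Longrightarrow> monotone_degree_one (F i t)"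
  shows "\<exists>d>0. \<forall>s\<in>A. \<forall>t\<in>A. \<bar>s - t\<bar> < d \<longrightarrow>
    (\<forall>n. \<bar>orbit F y s n - orbit F y t n\<bar> \<le> 2 * (real n / real N) + 2)"
proof -
  from uniformly_equicontinuous_orbits[OF F zero_less_one, of N]
  obtain d where d0: "d > 0" and block: "\<forall>n\<le>N. \<forall>k. \<forall>s\<in>A. \<forall>t\<in>A. \<forall>y z. \<bar>s - t\<bar> < d \<longrightarrow> \<bar>y - z\<bar> < d \<longrightarrow>
    \<bar>orbit (\<lambda>i. F (k + i)) y s n - orbit (\<lambda>i. F (k + i)) z t n\<bar> < 1"
    by (elim exE conjE)
  have d: "\<bar>orbit (\<lambda>i. F (k + i)) y s n - orbit (\<lambda>i. F (k + i)) y t n\<bar> < 1"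
    if "n \<le> N" "s \<in> A" "t \<in> A" "\<bar>s - t\<bar> < d" for n k s t y
    using block[rule_format, of n s t y y k] that d0 by simp
  define q where "q = (\<lambda>n. real n / real N)"
  have "\<bar>orbit F y s n - orbit F y t n\<bar> \<le> 2 * q n + 2"
    if st: "s \<in> A" "t \<in> A" "\<bar>s - t\<bar> < d" for s t n
  proof (induction n rule: less_induct)
    case (less n)
    show ?case
    proof (cases "n \<le> N")
      case True
      then have "\<bar>orbit F y s n - orbit F y t n\<bar> < 1"
        using d[of n s t 0 y] st by simp
      moreover have "q n \<ge> 0" by (simp add: q_def)
      ultimately show ?thesis by linarith
    next
      case False
      define k where "k = n - N"
      define B where "B = (\<lambda>r y. orbit (\<lambda>i. F (k + i)) y r N)"
      have n: "n = k + N" using False by (simp add: k_def)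
      let ?u = "orbit F y s k" and ?v = "orbit F y t k"
      have "\<bar>?u - ?v\<bar> \<le> 2 * q k + 2"
        using less.IH[of k] n \<open>N > 0\<close> by simp
      \<comment> \<open>The two units charged to a block: one for the different starting points,
        however far apart they already are, and one for changing the parameter.\<close>
      moreover have "\<bar>(B s ?u - B s ?v) - (?u - ?v)\<bar> \<le> 1"
        unfolding B_def using deg st
        by (intro monotone_degree_one_displacement monotone_degree_one_orbit) auto
      moreover have "\<bar>B s ?v - B t ?v\<bar> < 1"
        unfolding B_def using d st by simp
      moreover have "orbit F y s n = B s ?u" "orbit F y t n = B t ?v"
        by (simp_all add: n orbit_add B_def)
      moreover have "q n = q k + 1"
        using \<open>N > 0\<close> by (simp add: q_def n field_simps)
      ultimately show ?thesis by linarith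
    qed
  qed
  with d0 show ?thesis unfolding q_def by blast
qed

text \<open>Both conjugacies accumulate the same sum M of integers, which cancels. What remains are
  four displacement errors of at most 1 and the distance between H and H' at times 0 and n, hence 6.
  The lifts H i themselves may be unbounded in i.\<close>

lemma conjugate_orbits_bounded_difference:
  assumes degG: "\<And>i. monotone_degree_one (G i s)" "\<And>i. monotone_degree_one (G i t)"
    and degH: "\<And>i. monotone_degree_one (H i)" "\<And>i. monotone_degree_one (H' i)"
    and near: "\<And>i y. \<bar>H i y - H' i y\<bar> \<le> 1"
    and conj: "\<And>i y. H (Suc i) (F i s y) = G i s (H i y) + of_int (m i)"
      "\<And>i y. H' (Suc i) (F i t y) = G i t (H' i y) + of_int (m i)"
  shows "\<bar>(orbit F y s n - orbit G y s n) - (orbit F y t n - orbit G y t n)\<bar> \<le> 6"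
proof -
  define M where "M = (\<Sum>i<n. m i)"
  have orb: "K n (orbit F y r n) = orbit G (K 0 y) r n + of_int M"
    if "\<And>i. monotone_degree_one (G i r)"
      and "\<And>i y. K (Suc i) (F i r y) = G i r (K i y) + of_int (m i)" for K r
    unfolding M_def
    by (induction n) (simp_all add: that(2) monotone_degree_one_add_int[OF that(1)] del: of_int_sum)
  have "H n (orbit F y s n) = orbit G (H 0 y) s n + of_int M"
    "H' n (orbit F y t n) = orbit G (H' 0 y) t n + of_int M"
    using orb[of s H] orb[of t H'] degG conj by auto
  moreover have "\<bar>(H n (orbit F y s n) - H n 0) - (orbit F y s n - 0)\<bar> \<le> 1"
    "\<bar>(H' n (orbit F y t n) - H' n 0) - (orbit F y t n - 0)\<bar> \<le> 1"
    using degH monotone_degree_one_displacement by blast+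
  moreover have "\<bar>(orbit G (H 0 y) s n - orbit G y s n) - (H 0 y - y)\<bar> \<le> 1"
    "\<bar>(orbit G (H' 0 y) t n - orbit G y t n) - (H' 0 y - y)\<bar> \<le> 1"
    by (intro monotone_degree_one_displacement monotone_degree_one_orbit degG)+
  moreover have "\<bar>H n 0 - H' n 0\<bar> \<le> 1" "\<bar>H 0 y - H' 0 y\<bar> \<le> 1"
    using near by blast+
  ultimately show ?thesis by linarith
qed

section \<open>Parameter families with countably many asymptotic classes\<close>

lemma eventually_le_mult_of_nat:
  fixes e :: real
  assumes "e > 0"
  shows "\<forall>\<^sub>F n in sequentially. C \<le> e * real n"
proof -
  obtain N :: nat where N: "C / e < real N" using reals_Archimedean2 by blast
  show ?thesis
  proof (rule eventually_sequentiallyI)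
    fix n assume "N \<le> n"
    with N have "C / e \<le> real n" by linarith
    then show "C \<le> e * real n" using assms by (simp add: field_simps)
  qed
qed

text \<open>The argument on D, freed from dynamics. K labels the classes by a countable type, and
  continuity in t is required only asymptotically and on the scale of n.\<close>

lemma countable_asymptotic_classes:
  fixes A :: "nat \<Rightarrow> real \<Rightarrow> real" and K :: "real \<Rightarrow> 'k::countable"
  assumes "a \<le> b"
    and cont: "\<And>e. e > 0 \<Longrightarrow> \<exists>d>0. \<forall>s\<in>{a..b}. \<forall>t\<in>{a..b}. \<bar>s - t\<bar> < d \<longrightarrow>
      (\<forall>\<^sub>F n in sequentially. \<bar>A n s - A n t\<bar> \<le> e * real n)"
    and classes: "\<And>s t. s \<in> {a..b} \<Longrightarrow> t \<in> {a..b} \<Longrightarrow> K s = K t \<Longrightarrow> \<exists>C. \<forall>n. \<bar>A n s - A n t\<bar> \<le> C"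
  shows "(\<lambda>n. (A n b - A n a) / real n) \<longlonglongrightarrow> 0"
proof -
  define \<Delta> where "\<Delta> = (\<lambda>n t. (A n t - A n a) / real n)"
  \<comment> \<open>The infimum of the eventual upper bounds is the upper limit; truncating at 1
    puts 1 into every \<open>S t\<close>, so that the infimum is over a nonempty set.\<close>
  define S where "S = (\<lambda>t. {e. 0 \<le> e \<and> (\<forall>\<^sub>F n in sequentially. min 1 \<bar>\<Delta> n t\<bar> \<le> e)})"
  define D where "D = (\<lambda>t. Inf (S t))"
  have ne: "S t \<noteq> {}" for t
    by (auto simp: S_def intro!: exI[of _ 1])
  have bdd: "bdd_below (S t)" for t
    by (rule bdd_belowI[of _ 0]) (simp add: S_def)
  have D_le: "D t \<le> D s + e"
    if "e \<ge> 0" and ev: "\<forall>\<^sub>F n in sequentially. \<bar>A n s - A n t\<bar> \<le> e * real n" for s t e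
  proof -
    have "D t - e \<le> x" if x: "x \<in> S s" for x
    proof -
      have xs: "\<forall>\<^sub>F n in sequentially. min 1 \<bar>\<Delta> n s\<bar> \<le> x"
        using x by (simp add: S_def)
      have "\<forall>\<^sub>F n in sequentially. min 1 \<bar>\<Delta> n t\<bar> \<le> x + e"
        using ev eventually_gt_at_top[of 0] xs
      proof eventually_elim
        case (elim n)
        have "\<bar>\<Delta> n t - \<Delta> n s\<bar> = \<bar>A n s - A n t\<bar> / real n"
          by (simp add: \<Delta>_def diff_divide_distrib[symmetric] abs_minus_commute)
        also have "\<dots> \<le> e" using elim by (simp add: divide_le_eq)
        finally show ?case using elim(3) \<open>e \<ge> 0\<close> by linarith
      qed
      then have "x + e \<in> S t" using x \<open>e \<ge> 0\<close> by (simp add: S_def)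
      then have "D t \<le> x + e" unfolding D_def using bdd by (rule cInf_lower)
      then show ?thesis by simp
    qed
    then have "D t - e \<le> Inf (S s)" by (rule cInf_greatest[OF ne])
    moreover have "D s = Inf (S s)" by (simp add: D_def)
    ultimately show ?thesis by linarith
  qed
  have contD: "continuous_on {a..b} D"
    unfolding continuous_on_iff dist_real_def
  proof (intro ballI allI impI)
    fix t e :: real assume t: "t \<in> {a..b}" and "e > 0"
    from cont[OF half_gt_zero[OF \<open>e > 0\<close>]]
    obtain d where "d > 0" and d: "\<forall>s\<in>{a..b}. \<forall>t\<in>{a..b}. \<bar>s - t\<bar> < d \<longrightarrow>
      (\<forall>\<^sub>F n in sequentially. \<bar>A n s - A n t\<bar> \<le> e / 2 * real n)"
      by (elim exE conjE)
    have "\<bar>D s - D t\<bar> < e" if s: "s \<in> {a..b}" "\<bar>s - t\<bar> < d" for s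
    proof -
      have "D t \<le> D s + e / 2" using \<open>e > 0\<close> d s t by (intro D_le) auto
      moreover have "D s \<le> D t + e / 2"
        using \<open>e > 0\<close> d s t by (intro D_le) (auto simp: abs_minus_commute)
      ultimately show ?thesis using \<open>e > 0\<close> by linarith
    qed
    with \<open>d > 0\<close> show "\<exists>d>0. \<forall>s\<in>{a..b}. \<bar>s - t\<bar> < d \<longrightarrow> \<bar>D s - D t\<bar> < e" by blast
  qed
  have same: "D t \<le> D s" if st: "s \<in> {a..b}" "t \<in> {a..b}" "K s = K t" for s t
  proof (rule field_le_epsilon)
    fix e :: real assume "e > 0"
    obtain C where C: "\<And>n. \<bar>A n s - A n t\<bar> \<le> C" using classes[OF st] by blast
    have "\<forall>\<^sub>F n in sequentially. C \<le> e * real n"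
      using \<open>e > 0\<close> by (rule eventually_le_mult_of_nat)
    then have "\<forall>\<^sub>F n in sequentially. \<bar>A n s - A n t\<bar> \<le> e * real n"
    proof eventually_elim
      case (elim n)
      then show ?case using C[of n] by linarith
    qed
    then show "D t \<le> D s + e" using D_le \<open>e > 0\<close> by simp
  qed
  \<comment> \<open>D is constant on each class, so one representative per label exhausts its
    values.\<close>
  have "D ` {a..b} \<subseteq> range (\<lambda>k. D (inv_into {a..b} K k))"
  proof (clarify)
    fix t assume t: "t \<in> {a..b}"
    define s where "s = inv_into {a..b} K (K t)"
    have "s \<in> {a..b}" "K s = K t"
      unfolding s_def using t by (auto intro: inv_into_into f_inv_into_f simp del: atLeastAtMost_iff)
    then have "D t = D s" using same[of s t] same[of t s] t by (intro antisym) auto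
    then show "D t \<in> range (\<lambda>k. D (inv_into {a..b} K k))" by (auto simp: s_def)
  qed
  then have "countable (D ` {a..b})" by (rule countable_subset) auto
  moreover have "connected (D ` {a..b})"
    using contD by (intro connected_continuous_image) auto
  ultimately have "D b = D a"
    using connected_uncountable[of "D ` {a..b}" "D b" "D a"] \<open>a \<le> b\<close> by force
  also have "D a = 0"
  proof (rule antisym)
    have "0 \<in> S a" by (simp add: S_def \<Delta>_def)
    then show "D a \<le> 0" unfolding D_def using bdd by (rule cInf_lower)
    show "0 \<le> D a" unfolding D_def by (rule cInf_greatest[OF ne]) (simp add: S_def)
  qed
  finally have Db: "D b = 0" .
  have "(\<lambda>n. \<Delta> n b) \<longlonglongrightarrow> 0"
  proof (rule tendstoI)
    fix e :: real assume "e > 0"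
    \<comment> \<open>A bound x below 1 makes the truncation harmless: it then bounds the
      untruncated quotient.\<close>
    then have "Inf (S b) < min 1 e" using Db by (simp add: D_def)
    then obtain x where x: "x \<in> S b" "x < min 1 e" using cInf_lessD[OF ne] by blast
    then have "\<forall>\<^sub>F n in sequentially. min 1 \<bar>\<Delta> n b\<bar> \<le> x" by (simp add: S_def)
    then show "\<forall>\<^sub>F n in sequentially. dist (\<Delta> n b) 0 < e"
      by eventually_elim (use x(2) in auto)
  qed
  then show ?thesis by (simp add: \<Delta>_def)
qed

text \<open>\<open>K s = K t\<close> stands for: the maps conjugating at the parameters \<open>s\<close> and \<open>t\<close> are uniformly
  close, so that the integer defects \<open>m\<close> agree.\<close>

lemma conjugate_lifts_same_displacement:
  fixes F G :: "nat \<Rightarrow> real \<Rightarrow> real \<Rightarrow> real" and K :: "real \<Rightarrow> 'k::countable"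
  assumes "a \<le> b"
    and F: "uniformly_equicontinuous {a..b} F" "\<And>i t. t \<in> {a..b} \<Longrightarrow> monotone_degree_one (F i t)"
    and G: "uniformly_equicontinuous {a..b} G" "\<And>i t. t \<in> {a..b} \<Longrightarrow> monotone_degree_one (G i t)"
    and conj: "\<And>s t. s \<in> {a..b} \<Longrightarrow> t \<in> {a..b} \<Longrightarrow> K s = K t \<Longrightarrow>
      \<exists>H H' m. (\<forall>i. monotone_degree_one (H i) \<and> monotone_degree_one (H' i)) \<and>
        (\<forall>i y. \<bar>H i y - H' i y\<bar> \<le> 1) \<and>
        (\<forall>i y. H (Suc i) (F i s y) = G i s (H i y) + of_int (m i)) \<and>
        (\<forall>i y. H' (Suc i) (F i t y) = G i t (H' i y) + of_int (m i))"
  shows "(\<lambda>n. ((orbit F y b n - orbit F y a n) - (orbit G y b n - orbit G y a n)) / real n) \<longlonglongrightarrow> 0"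
proof -
  define A where "A = (\<lambda>n t. orbit F y t n - orbit G y t n)"
  have "(\<lambda>n. (A n b - A n a) / real n) \<longlonglongrightarrow> 0"
  proof (rule countable_asymptotic_classes[where K = K, OF \<open>a \<le> b\<close>])
    fix e :: real assume "e > 0"
    \<comment> \<open>The displacement bounds for F and G add up to 4 n / N + 4. This N absorbs the
      first term into e n / 2, and large n absorbs the constant into the other half.\<close>
    then obtain N :: nat where N: "N > 0" "4 / real N < e / 2"
    proof -
      obtain N :: nat where "8 / e < real N" using reals_Archimedean2 by blast
      moreover from this \<open>e > 0\<close> have "N > 0" by (auto intro: gr0I simp: field_simps)
      ultimately show ?thesis using \<open>e > 0\<close> by (intro that[of N]) (auto simp: field_simps)
    qed
    obtain d1 where d1: "d1 > 0" "\<forall>s\<in>{a..b}. \<forall>t\<in>{a..b}. \<bar>s - t\<bar> < d1 \<longrightarrow>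
      (\<forall>n. \<bar>orbit F y s n - orbit F y t n\<bar> \<le> 2 * (real n / real N) + 2)"
      using orbit_displacement_parameter[OF F(1) \<open>N > 0\<close>, of y] F(2) by blast
    obtain d2 where d2: "d2 > 0" "\<forall>s\<in>{a..b}. \<forall>t\<in>{a..b}. \<bar>s - t\<bar> < d2 \<longrightarrow>
      (\<forall>n. \<bar>orbit G y s n - orbit G y t n\<bar> \<le> 2 * (real n / real N) + 2)"
      using orbit_displacement_parameter[OF G(1) \<open>N > 0\<close>, of y] G(2) by blast
    have "\<forall>\<^sub>F n in sequentially. \<bar>A n s - A n t\<bar> \<le> e * real n"
      if st: "s \<in> {a..b}" "t \<in> {a..b}" "\<bar>s - t\<bar> < min d1 d2" for s t
    proof -
      have "\<forall>\<^sub>F n in sequentially. 4 \<le> e / 2 * real n"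
        using \<open>e > 0\<close> by (intro eventually_le_mult_of_nat) simp
      then show ?thesis
      proof eventually_elim
        case (elim n)
        have "\<bar>orbit F y s n - orbit F y t n\<bar> \<le> 2 * (real n / real N) + 2"
          "\<bar>orbit G y s n - orbit G y t n\<bar> \<le> 2 * (real n / real N) + 2"
          using d1(2) d2(2) st by auto
        then have "\<bar>A n s - A n t\<bar> \<le> 4 * (real n / real N) + 4"
          unfolding A_def by linarith
        also have "\<dots> = 4 / real N * real n + 4" by (simp add: field_simps)
        also have "\<dots> \<le> e / 2 * real n + e / 2 * real n"
          using N(2) elim by (intro add_mono mult_right_mono) auto
        finally show ?case by simp
      qed
    qed
    then show "\<exists>d>0. \<forall>s\<in>{a..b}. \<forall>t\<in>{a..b}. \<bar>s - t\<bar> < d \<longrightarrow>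
      (\<forall>\<^sub>F n in sequentially. \<bar>A n s - A n t\<bar> \<le> e * real n)"
      using d1(1) d2(1) by (intro exI[of _ "min d1 d2"]) simp
  next
    fix s t assume st: "s \<in> {a..b}" "t \<in> {a..b}" "K s = K t"
    obtain H H' m where "\<forall>i. monotone_degree_one (H i) \<and> monotone_degree_one (H' i)"
      "\<forall>i y. \<bar>H i y - H' i y\<bar> \<le> 1"
      "\<forall>i y. H (Suc i) (F i s y) = G i s (H i y) + of_int (m i)"
      "\<forall>i y. H' (Suc i) (F i t y) = G i t (H' i y) + of_int (m i)"
      using conj[OF st] by (elim exE conjE)
    then show "\<exists>C. \<forall>n. \<bar>A n s - A n t\<bar> \<le> C"
      unfolding A_def using st G(2)
      by (intro exI[of _ 6] allI conjugate_orbits_bounded_difference[of G s t H H' F m]) auto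
  qed
  then show ?thesis by (simp add: A_def algebra_simps)
qed


section \<open>Uniform covers of the fibers\<close>

lemma dist_cis_eq: "dist (cis (2 * pi * y)) (cis (2 * pi * z)) = dist (cis (2 * pi * (y - z))) 1"
proof -
  have "cis (2 * pi * y) = cis (2 * pi * z) * cis (2 * pi * (y - z))"
    by (simp add: cis_mult algebra_simps)
  then have "cis (2 * pi * y) - cis (2 * pi * z) = cis (2 * pi * z) * (cis (2 * pi * (y - z)) - 1)"
    by (simp add: algebra_simps)
  then have "norm (cis (2 * pi * y) - cis (2 * pi * z)) = norm (cis (2 * pi * (y - z)) - 1)"
    by (simp add: norm_mult)
  then show ?thesis by (simp add: dist_norm)
qed

lemma continuous_on_cis_2pi: "continuous_on S (\<lambda>y. cis (2 * pi * y))"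
  unfolding cis_conv_exp by (intro continuous_intros)

lemma cis_2pi_uniformly_continuous:
  assumes "e > 0"
  obtains d where "d > 0" "\<And>y z. \<bar>y - z\<bar> < d \<Longrightarrow> dist (cis (2 * pi * y)) (cis (2 * pi * z)) < e"
proof -
  obtain d where d: "d > 0" "\<And>w. \<bar>w\<bar> < d \<Longrightarrow> dist (cis (2 * pi * w)) (cis (2 * pi * 0)) < e"
    using continuous_on_cis_2pi[of UNIV, unfolded continuous_on_iff, rule_format, of 0 e] assms
    by (auto simp: dist_real_def)
  show ?thesis
    by (rule that[OF d(1)]) (use d(2) in \<open>simp add: dist_cis_eq[of _ "_ :: real"]\<close>)
qed

lemma cis_2pi_eq_imp_integer:
  assumes "cis (2 * pi * y) = cis (2 * pi * z)"
  shows "y - z \<in> \<int>"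
proof -
  have "cis (2 * pi * (y - z)) = 1" using dist_cis_eq[of y z] assms by simp
  then have "cos (2 * pi * (y - z)) = 1" by (simp add: complex_eq_iff)
  then obtain n :: int where "2 * pi * (y - z) = of_int n * 2 * pi"
    using cos_one_2pi_int by auto
  then have "y - z = of_int n" by simp
  then show ?thesis by simp
qed

text \<open>On the compact interval [e, 1 - e] the distance of cis (2 pi w) to 1 attains a positive
  minimum, so a smaller distance forces the fractional part of y - z to be within e of 0 or 1. For e
  > 1/2 the interval is empty.\<close>

lemma cis_2pi_near_imp_near_integer:
  assumes "e > 0"
  obtains d where "d > 0"
    "\<And>y z. dist (cis (2 * pi * y)) (cis (2 * pi * z)) < d \<Longrightarrow> \<exists>m\<in>\<int>. \<bar>y - z - m\<bar> < e"
proof -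
  define f where "f = (\<lambda>w::real. dist (cis (2 * pi * w)) 1)"
  have pos: "f w > 0" if "0 < w" "w < 1" for w
  proof (rule ccontr)
    assume "\<not> f w > 0"
    then have "cis (2 * pi * w) = cis (2 * pi * 0)" by (simp add: f_def)
    then have "w - 0 \<in> \<int>" by (rule cis_2pi_eq_imp_integer)
    then show False using that Ints_nonzero_abs_less1[of w] by auto
  qed
  have "\<exists>d>0. \<forall>w\<in>{e..1 - e}. d \<le> f w"
  proof (cases "{e..1 - e} = {}")
    case False
    have "continuous_on {e..1 - e} f"
      unfolding f_def by (intro continuous_intros continuous_on_cis_2pi)
    then obtain w0 where "w0 \<in> {e..1 - e}" "\<forall>w\<in>{e..1 - e}. f w0 \<le> f w"
      using continuous_attains_inf[OF compact_Icc False] by blast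
    then show ?thesis using pos[of w0] \<open>e > 0\<close> by auto
  qed (auto intro: exI[of _ 1])
  then obtain d where d: "d > 0" "\<And>w. w \<in> {e..1 - e} \<Longrightarrow> d \<le> f w" by blast
  have "\<exists>m\<in>\<int>. \<bar>y - z - m\<bar> < e" if *: "dist (cis (2 * pi * y)) (cis (2 * pi * z)) < d" for y z
  proof -
    define w where "w = frac (y - z)"
    have w: "y - z = w + of_int \<lfloor>y - z\<rfloor>" by (simp add: w_def frac_def)
    have "f w = dist (cis (2 * pi * y)) (cis (2 * pi * z))"
    proof -
      have "cis (2 * pi * (y - z)) = cis (2 * pi * w) * cis (2 * pi * of_int \<lfloor>y - z\<rfloor>)"
        unfolding cis_mult by (subst w) (simp add: algebra_simps)
      also have "\<dots> = cis (2 * pi * w)" by simp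
      finally show ?thesis by (simp add: f_def dist_cis_eq[of y])
    qed
    then have "w \<notin> {e..1 - e}" using * d(2)[of w] by auto
    then consider "w < e" | "1 - e < w" by fastforce
    then show ?thesis
    proof cases
      case 1
      then show ?thesis using w frac_ge_0[of "y - z"]
        by (intro bexI[of _ "of_int \<lfloor>y - z\<rfloor>"]) (auto simp: w_def)
    next
      case 2
      then show ?thesis using w frac_lt_1[of "y - z"]
        by (intro bexI[of _ "of_int (\<lfloor>y - z\<rfloor> + 1)"]) (auto simp: w_def)
    qed
  qed
  with d(1) show ?thesis by (rule that)
qed

lemma finite_uniform_positive:
  fixes P :: "'j \<Rightarrow> real \<Rightarrow> bool"
  assumes "finite J" "\<And>j. j \<in> J \<Longrightarrow> \<exists>d>0. P j d"
    and mono: "\<And>j d d'. P j d \<Longrightarrow> d' \<le> d \<Longrightarrow> P j d'"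
  shows "\<exists>d>0. \<forall>j\<in>J. P j d"
  using assms(1,2)
proof (induction J rule: finite_induct)
  case (insert i J)
  then obtain d where "d > 0" "\<forall>j\<in>J. P j d" by auto
  moreover from insert.prems[of i] obtain d' where "d' > 0" "P i d'" by auto
  ultimately
  show ?case
    by (intro exI[of _ "min d d'"]) (auto intro: mono[where d = d] mono[where d = d'])
qed (auto intro: exI[of _ 1])

text \<open>A trivialisation over a closed ball: with compact base, its domain and image are
  compact, so \<open>h\<close> and \<open>k\<close> are uniformly continuous. Of the inverse,
  \<open>k\<close> keeps the circle coordinate.\<close>

definition oriented_chart ::
  "('e::topological_space \<Rightarrow> 'x::metric_space) \<Rightarrow> ('x \<Rightarrow> (real \<Rightarrow> 'e) set) \<Rightarrow> 'x \<Rightarrow> real \<Rightarrow>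
     ('x \<times> complex \<Rightarrow> 'e) \<Rightarrow> ('e \<Rightarrow> complex) \<Rightarrow> bool" where
  "oriented_chart p ori x r h k \<longleftrightarrow> r > 0 \<and> continuous_on (cball x r \<times> unit_circle) h \<and>
    continuous_on (p -` cball x r) k \<and> p -` cball x r = h ` (cball x r \<times> unit_circle) \<and>
    (\<forall>y\<in>cball x r. \<forall>z\<in>unit_circle. p (h (y, z)) = y \<and> k (h (y, z)) = z) \<and>
    (\<forall>y\<in>cball x r. (\<lambda>t. h (y, cis (2 * pi * t))) \<in> ori y)"

lemma oriented_circle_bundle_chart:
  assumes "oriented_circle_bundle p ori"
  shows "\<exists>r h k. oriented_chart p ori x r h k"
proof -
  from assms obtain U h k where U: "open U" "x \<in> U"
    and hom: "homeomorphism (U \<times> unit_circle) (p -` U) h k"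
    and ph: "\<forall>y\<in>U. \<forall>z\<in>unit_circle. p (h (y, z)) = y"
    and ori: "\<forall>y\<in>U. (\<lambda>t. h (y, cis (2 * pi * t))) \<in> ori y"
    unfolding oriented_circle_bundle_def by meson
  obtain r where r: "r > 0" "cball x r \<subseteq> U"
    using U open_contains_cball by blast
  have sub: "cball x r \<times> unit_circle \<subseteq> U \<times> unit_circle" "p -` cball x r \<subseteq> p -` U"
    using r(2) by auto
  have img: "p -` cball x r = h ` (cball x r \<times> unit_circle)"
  proof (intro equalityI subsetI)
    fix u assume u: "u \<in> p -` cball x r"
    then have "u \<in> p -` U" using sub by auto
    then have "h (k u) = u" by (rule homeomorphism_apply2[OF hom])
    have ku: "k u \<in> U \<times> unit_circle"
      using homeomorphism_image2[OF hom] \<open>u \<in> p -` U\<close> by blast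
    moreover from ku ph have "p (h (k u)) = fst (k u)" by (cases "k u") auto
    ultimately have "fst (k u) \<in> cball x r" using u \<open>h (k u) = u\<close> by simp
    then have "k u \<in> cball x r \<times> unit_circle" using ku by (simp add: mem_Times_iff)
    then show "u \<in> h ` (cball x r \<times> unit_circle)" using \<open>h (k u) = u\<close> by (metis image_eqI)
  next
    fix u assume "u \<in> h ` (cball x r \<times> unit_circle)"
    then show "u \<in> p -` cball x r" using ph r(2) by auto
  qed
  have "continuous_on (p -` cball x r) (\<lambda>u. snd (k u))"
    using hom sub(2) by (intro continuous_on_snd) (auto simp: homeomorphism_def intro: continuous_on_subset)
  moreover have "continuous_on (cball x r \<times> unit_circle) h"
    using hom sub(1) by (auto simp: homeomorphism_def intro: continuous_on_subset)
  moreover have "snd (k (h (y, z))) = z" if "y \<in> cball x r" "z \<in> unit_circle" for y z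
  proof -
    have "(y, z) \<in> U \<times> unit_circle" using that r(2) by auto
    then show ?thesis using hom by (simp add: homeomorphism_def)
  qed
  ultimately have "oriented_chart p ori x r h (\<lambda>u. snd (k u))"
    using r ph ori img unfolding oriented_chart_def by (simp add: subset_iff)
  then show ?thesis by blast
qed

text \<open>One oriented cover \<open>B x\<close> per fiber, without continuity in x but with moduli
  uniform in x. \<open>B_separated\<close> is the converse modulus: nearness in the fiber gives
  nearness modulo the integers. The coordinate \<open>\<kappa> x\<close> makes lifts available
  through complex logarithms.\<close>

locale uniform_fiber_covers =
  fixes p :: "'e::metric_space \<Rightarrow> 'x" and ori :: "'x \<Rightarrow> (real \<Rightarrow> 'e) set"
    and B :: "'x \<Rightarrow> real \<Rightarrow> 'e" and \<kappa> :: "'x \<Rightarrow> 'e \<Rightarrow> complex"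
  assumes compact_total: "compact (UNIV :: 'e set)"
    and orientation: "circle_orientation (fiber p x) (ori x)"
    and B_oriented: "B x \<in> ori x"
    and continuous_kappa: "continuous_on (fiber p x) (\<kappa> x)"
    and kappa_B: "\<kappa> x (B x y) = cis (2 * pi * y)"
    and B_uniformly_continuous:
      "e > 0 \<Longrightarrow> \<exists>d>0. \<forall>x y z. \<bar>y - z\<bar> < d \<longrightarrow> dist (B x y) (B x z) < e"
    and B_separated:
      "e > 0 \<Longrightarrow> \<exists>d>0. \<forall>x y z. dist (B x y) (B x z) < d \<longrightarrow> (\<exists>m\<in>\<int>. \<bar>y - z - m\<bar> < e)"

text \<open>Each x picks one chart \<open>j x\<close> out of a finite subcover, and
  \<open>B x\<close> is read off from it. Uniformity in x is then a minimum over finitely many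
  charts; the same charts exhibit the total space as a finite union of compact sets.\<close>

lemma uniform_fiber_covers_exist:
  fixes p :: "'e::metric_space \<Rightarrow> 'x::metric_space"
  assumes compact: "compact (UNIV :: 'x set)" and fiber_bundle: "oriented_circle_bundle p ori"
  shows "\<exists>B \<kappa>. uniform_fiber_covers p ori B \<kappa>"
proof -
  obtain r h k where "\<And>x. oriented_chart p ori x (r x) (h x) (k x)"
    using oriented_circle_bundle_chart[OF fiber_bundle] by metis
  then have r: "r x > 0" and h: "continuous_on (cball x (r x) \<times> unit_circle) (h x)"
    and k: "continuous_on (p -` cball x (r x)) (k x)"
    and img: "p -` cball x (r x) = h x ` (cball x (r x) \<times> unit_circle)"
    and hk: "y \<in> cball x (r x) \<Longrightarrow> z \<in> unit_circle \<Longrightarrow> p (h x (y, z)) = y \<and> k x (h x (y, z)) = z"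
    and h_ori: "y \<in> cball x (r x) \<Longrightarrow> (\<lambda>t. h x (y, cis (2 * pi * t))) \<in> ori y" for x y z
    unfolding oriented_chart_def by blast+
  obtain J where J: "finite J" "UNIV \<subseteq> (\<Union>x\<in>J. ball x (r x))"
  proof (rule compactE_image[OF compact, of UNIV "\<lambda>x. ball x (r x)"])
    show "UNIV \<subseteq> (\<Union>x. ball x (r x))"
    proof
      fix x show "x \<in> (\<Union>x. ball x (r x))" using r[of x] by (intro UN_I[of x]) auto
    qed
  qed (use that in auto)
  define j where "j = (\<lambda>x. SOME i. i \<in> J \<and> x \<in> ball i (r i))"
  have j: "j x \<in> J" "x \<in> cball (j x) (r (j x))" for x
  proof -
    have "\<exists>i. i \<in> J \<and> x \<in> ball i (r i)" using J(2) by blast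
    then have "j x \<in> J \<and> x \<in> ball (j x) (r (j x))" unfolding j_def by (rule someI_ex)
    then show "j x \<in> J" "x \<in> cball (j x) (r (j x))" by auto
  qed
  have compact_cball: "compact (cball x (r x))" for x
    using compact closed_Int_compact[OF closed_cball, of UNIV x "r x"] by simp
  have compact_dom: "compact (cball x (r x) \<times> unit_circle)" for x
    using compact_cball by (intro compact_Times) auto
  have compact_preimage: "compact (p -` cball x (r x))" for x
    unfolding img by (rule compact_continuous_image[OF h compact_dom])
  have "UNIV = (\<Union>x\<in>J. p -` cball x (r x))"
    using j by blast
  moreover have "compact (\<Union>x\<in>J. p -` cball x (r x))"
    using J(1) compact_preimage by (intro compact_UN) auto
  ultimately have compact_total: "compact (UNIV :: 'e set)" by simp
  define B where "B = (\<lambda>x t. h (j x) (x, cis (2 * pi * t)))"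
  define \<kappa> where kappa_def: "\<kappa> = (\<lambda>x. k (j x))"
  have in_dom: "(x, cis (2 * pi * t)) \<in> cball (j x) (r (j x)) \<times> unit_circle" for x t
    using j(2) by simp
  have B_ori: "B x \<in> ori x" for x
    unfolding B_def by (rule h_ori[OF j(2)])
  have B_fiber: "p (B x y) = x" and kappa_B: "\<kappa> x (B x y) = cis (2 * pi * y)" for x y
    unfolding B_def kappa_def using hk[OF j(2)] by simp_all
  have B_preimage: "B x y \<in> p -` cball (j x) (r (j x))" for x y
    using B_fiber j(2) by (simp del: mem_cball)
  show ?thesis
  proof (intro exI, unfold_locales)
    show "compact (UNIV :: 'e set)" by (rule compact_total)
    show "circle_orientation (fiber p x) (ori x)" for x
      using fiber_bundle by (simp add: oriented_circle_bundle_def)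
    show "B x \<in> ori x" for x by (rule B_ori)
    show "continuous_on (fiber p x) (\<kappa> x)" for x
    proof -
      have "fiber p x \<subseteq> p -` cball (j x) (r (j x))" using j(2)[of x] by blast
      then show ?thesis unfolding kappa_def by (rule continuous_on_subset[OF k])
    qed
    show "\<kappa> x (B x y) = cis (2 * pi * y)" for x y by (rule kappa_B)
  next
    fix e :: real assume "e > 0"
    define P where "P = (\<lambda>i d. \<forall>u\<in>cball i (r i) \<times> unit_circle. \<forall>v\<in>cball i (r i) \<times> unit_circle.
      dist u v < d \<longrightarrow> dist (h i u) (h i v) < e)"
    have "\<exists>d>0. \<forall>i\<in>J. P i d"
    proof (rule finite_uniform_positive[OF J(1)])
      fix i
      have "uniformly_continuous_on (cball i (r i) \<times> unit_circle) (h i)"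
        by (rule compact_uniformly_continuous[OF h compact_dom])
      then show "\<exists>d>0. P i d"
        unfolding P_def uniformly_continuous_on_def using \<open>e > 0\<close> by (metis dist_commute)
    qed (auto simp: P_def)
    then obtain d where d: "d > 0" "\<And>i. i \<in> J \<Longrightarrow> P i d" by blast
    obtain d' where d': "d' > 0" "\<And>y z. \<bar>y - z\<bar> < d' \<Longrightarrow> dist (cis (2 * pi * y)) (cis (2 * pi * z)) < d"
      using cis_2pi_uniformly_continuous[OF d(1)] by blast
    have "dist (B x y) (B x z) < e" if "\<bar>y - z\<bar> < d'" for x y z
    proof -
      have "dist (x, cis (2 * pi * y)) (x, cis (2 * pi * z)) < d"
        using d'(2)[OF that] by (simp add: dist_Pair_Pair)
      then show ?thesis
        unfolding B_def using d(2)[OF j(1)[of x], unfolded P_def] in_dom by blast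
    qed
    with d'(1) show "\<exists>d>0. \<forall>x y z. \<bar>y - z\<bar> < d \<longrightarrow> dist (B x y) (B x z) < e" by blast
  next
    fix e :: real assume "e > 0"
    obtain d' where d': "d' > 0"
      "\<And>y z. dist (cis (2 * pi * y)) (cis (2 * pi * z)) < d' \<Longrightarrow> \<exists>m\<in>\<int>. \<bar>y - z - m\<bar> < e"
      using cis_2pi_near_imp_near_integer[OF \<open>e > 0\<close>] by blast
    define P where "P = (\<lambda>i d. \<forall>u\<in>p -` cball i (r i). \<forall>v\<in>p -` cball i (r i).
      dist u v < d \<longrightarrow> dist (k i u) (k i v) < d')"
    have "\<exists>d>0. \<forall>i\<in>J. P i d"
    proof (rule finite_uniform_positive[OF J(1)])
      fix i
      have "uniformly_continuous_on (p -` cball i (r i)) (k i)"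
        by (rule compact_uniformly_continuous[OF k compact_preimage])
      then show "\<exists>d>0. P i d"
        unfolding P_def uniformly_continuous_on_def using \<open>d' > 0\<close> by (metis dist_commute)
    qed (auto simp: P_def)
    then obtain d where d: "d > 0" "\<And>i. i \<in> J \<Longrightarrow> P i d" by blast
    have "\<exists>m\<in>\<int>. \<bar>y - z - m\<bar> < e" if "dist (B x y) (B x z) < d" for x y z
    proof -
      have "dist (\<kappa> x (B x y)) (\<kappa> x (B x z)) < d'"
        unfolding kappa_def using d(2)[OF j(1)[of x], unfolded P_def] B_preimage that by blast
      then show ?thesis unfolding kappa_B by (rule d'(2))
    qed
    with d(1) show "\<exists>d>0. \<forall>x y z. dist (B x y) (B x z) < d \<longrightarrow> (\<exists>m\<in>\<int>. \<bar>y - z - m\<bar> < e)" by blast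
  qed
qed


section \<open>Lifts of paths of fiber maps\<close>

lemma dist_Pair_le: "dist (x, y) (x', y') \<le> dist x x' + dist y y'"
  by (simp add: dist_Pair_Pair sqrt_sum_squares_le_sum)

text \<open>Uniform convergence handles the change of parameter at all points at once, leaving the
  continuity of the single map at t.\<close>

lemma Sk_path_continuous:
  assumes "Sk_path p ori S a b \<phi>"
  shows "continuous_on ({a..b} \<times> UNIV) (\<lambda>z. \<phi> (fst z) (snd z))"
  unfolding continuous_on_iff
proof (intro ballI allI impI)
  fix z :: "real \<times> 'a" and e :: real
  assume z: "z \<in> {a..b} \<times> UNIV" and "e > 0"
  define t u where "t = fst z" and "u = snd z"
  have t: "t \<in> {a..b}" using z by (auto simp: t_def)
  have "continuous_on UNIV (\<phi> t)" and lim: "uniform_limit UNIV \<phi> (\<phi> t) (at t within {a..b})"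
    using assms t by (auto simp: Sk_path_def Sk_plus_def)
  then have "\<exists>d>0. \<forall>v\<in>UNIV. dist v u < d \<longrightarrow> dist (\<phi> t v) (\<phi> t u) < e / 2"
    using half_gt_zero[OF \<open>e > 0\<close>] unfolding continuous_on_iff by blast
  then obtain d1 where d1: "d1 > 0" "\<forall>v. dist v u < d1 \<longrightarrow> dist (\<phi> t v) (\<phi> t u) < e / 2"
    by auto
  have "\<forall>\<^sub>F s in at t within {a..b}. \<forall>v\<in>UNIV. dist (\<phi> s v) (\<phi> t v) < e / 2"
    using lim half_gt_zero[OF \<open>e > 0\<close>] unfolding uniform_limit_iff by blast
  then obtain d2 where d2: "d2 > 0"
    "\<forall>s\<in>{a..b}. s \<noteq> t \<and> dist s t < d2 \<longrightarrow> (\<forall>v\<in>UNIV. dist (\<phi> s v) (\<phi> t v) < e / 2)"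
    unfolding eventually_at by blast
  have "dist (\<phi> (fst w) (snd w)) (\<phi> t u) < e"
    if w: "w \<in> {a..b} \<times> UNIV" "dist w z < min d1 d2" for w
  proof -
    have "dist (fst w) t < d2" "dist (snd w) u < d1"
      using w(2) dist_fst_le[of w z] dist_snd_le[of w z] by (auto simp: t_def u_def)
    moreover have "fst w \<in> {a..b}" using w(1) by (simp add: mem_Times_iff)
    ultimately have "dist (\<phi> (fst w) (snd w)) (\<phi> t (snd w)) < e / 2"
      using d2(2) \<open>e > 0\<close> by (cases "fst w = t") simp_all
    moreover have "dist (\<phi> t (snd w)) (\<phi> t u) < e / 2"
      using d1(2) \<open>dist (snd w) u < d1\<close> by blast
    ultimately show ?thesis
      using dist_triangle[of "\<phi> (fst w) (snd w)" "\<phi> t u" "\<phi> t (snd w)"] by linarith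
  qed
  then show "\<exists>d>0. \<forall>w\<in>{a..b} \<times> UNIV. dist w z < d \<longrightarrow>
      dist (\<phi> (fst w) (snd w)) (\<phi> (fst z) (snd z)) < e"
    using d1(1) d2(1) by (intro exI[of _ "min d1 d2"]) (simp add: t_def u_def)
qed

context uniform_fiber_covers
begin

lemma B_cover: "circle_cover (fiber p x) (B x)"
  using circle_orientation_cover[OF orientation B_oriented] .

lemma B_eq_iff: "B x y = B x z \<longleftrightarrow> y - z \<in> \<int>"
  by (rule circle_cover_eq_iff[OF B_cover])

lemma B_surj: "p u = x \<Longrightarrow> \<exists>y. u = B x y"
  using circle_cover_range[OF B_cover, of x] by blast

lemma p_B: "p (B x y) = x"
  using circle_cover_range[OF B_cover, of x] by blast

text \<open>In the circle coordinate the map is nonvanishing on a convex, hence contractible, set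
  and so has a continuous logarithm L. As it has modulus 1, L is purely imaginary, and Im L / (2 pi)
  is the lift.\<close>

lemma fiber_lift_exists:
  fixes \<Phi> :: "'v::real_normed_vector \<Rightarrow> 'e"
  assumes "convex S" "continuous_on S \<Phi>" "\<And>s. s \<in> S \<Longrightarrow> p (\<Phi> s) = x"
  shows "\<exists>F. continuous_on S F \<and> (\<forall>s\<in>S. B x (F s) = \<Phi> s)"
proof -
  define g where "g = (\<lambda>s. \<kappa> x (\<Phi> s))"
  have g: "\<exists>y. \<Phi> s = B x y \<and> g s = cis (2 * pi * y)" if "s \<in> S" for s
    using B_surj[OF assms(3)[OF that]] kappa_B by (auto simp: g_def)
  have "continuous_on S g"
    unfolding g_def using assms by (intro continuous_on_compose2[OF continuous_kappa[of x]]) auto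
  moreover have "g s \<noteq> 0" if "s \<in> S" for s
    using g[OF that] by auto
  ultimately obtain L where L: "continuous_on S L" "\<And>s. s \<in> S \<Longrightarrow> g s = exp (L s)"
    using continuous_logarithm_on_contractible[OF _ convex_imp_contractible[OF assms(1)]] by blast
  have "B x (Im (L s) / (2 * pi)) = \<Phi> s" if s: "s \<in> S" for s
  proof -
    obtain y where y: "\<Phi> s = B x y" "g s = cis (2 * pi * y)" using g[OF s] by blast
    have "norm (exp (L s)) = 1" using y(2) L(2)[OF s] by simp
    then have "exp (Re (L s)) = 1" by (simp only: norm_exp_eq_Re)
    then have "exp (L s) = cis (Im (L s))" by (simp only: exp_eq_polar[of "L s"]) simp
    then have "cis (2 * pi * (Im (L s) / (2 * pi))) = cis (2 * pi * y)"
      using y(2) L(2)[OF s] by simp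
    then show ?thesis using cis_2pi_eq_imp_integer y(1) by (simp add: B_eq_iff)
  qed
  moreover have "continuous_on S (\<lambda>s. Im (L s) / (2 * pi))"
    using L(1) by (intro continuous_intros) auto
  ultimately show ?thesis by blast
qed

text \<open>The lifts are continuous in time and fiber coordinate jointly; across fibers they share
  only the modulus in the last conjunct.\<close>

definition lifts_path ::
  "('x \<Rightarrow> 'x) \<Rightarrow> real \<Rightarrow> real \<Rightarrow> (real \<Rightarrow> 'e \<Rightarrow> 'e) \<Rightarrow> ('x \<Rightarrow> real \<Rightarrow> real \<Rightarrow> real) \<Rightarrow> bool" where
  "lifts_path S a b \<phi> F \<longleftrightarrow>
     (\<forall>x. continuous_on ({a..b} \<times> UNIV) (\<lambda>z. F x (fst z) (snd z))) \<and>
     (\<forall>x. \<forall>t\<in>{a..b}. monotone_degree_one (F x t)) \<and>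
     (\<forall>x. \<forall>t\<in>{a..b}. \<forall>y. B (S x) (F x t y) = \<phi> t (B x y)) \<and>
     (\<forall>e>0. \<exists>d>0. \<forall>x. \<forall>s\<in>{a..b}. \<forall>t\<in>{a..b}. \<forall>y z.
        \<bar>s - t\<bar> < d \<longrightarrow> \<bar>y - z\<bar> < d \<longrightarrow> \<bar>F x s y - F x t z\<bar> < e)"

lemma lifts_path_exist:
  assumes \<phi>: "Sk_path p ori S a b \<phi>"
  shows "\<exists>F. lifts_path S a b \<phi> F"
proof -
  define \<Phi> where "\<Phi> = (\<lambda>z. \<phi> (fst z) (snd z))"
  have cont: "continuous_on ({a..b} \<times> UNIV) \<Phi>"
    unfolding \<Phi>_def by (rule Sk_path_continuous[OF \<phi>])
  have B_cont: "continuous_on UNIV (B x)" for x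
    by (rule circle_cover_continuous[OF B_cover])
  have Sk: "\<phi> t \<in> Sk_plus p ori S" if "t \<in> {a..b}" for t
    using \<phi> that by (auto simp: Sk_path_def)
  have cont': "continuous_on ({a..b} \<times> UNIV) (\<lambda>z. \<phi> (fst z) (B x (snd z)))" for x
  proof -
    have "continuous_on ({a..b} \<times> UNIV) (\<lambda>z. (fst z, B x (snd z)))"
      by (intro continuous_intros continuous_on_compose2[OF B_cont]) auto
    then have "continuous_on ({a..b} \<times> UNIV) (\<lambda>z. \<Phi> (fst z, B x (snd z)))"
      by (rule continuous_on_compose2[OF cont]) auto
    then show ?thesis by (simp add: \<Phi>_def)
  qed
  have "\<exists>F. continuous_on ({a..b} \<times> (UNIV :: real set)) F \<and>
      (\<forall>z\<in>{a..b} \<times> UNIV. B (S x) (F z) = \<phi> (fst z) (B x (snd z)))" for x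
    using Sk by (intro fiber_lift_exists cont' convex_Times) (auto simp: Sk_plus_def p_B)
  then obtain F' where F': "\<And>x. continuous_on ({a..b} \<times> (UNIV :: real set)) (F' x) \<and>
      (\<forall>z\<in>{a..b} \<times> UNIV. B (S x) (F' x z) = \<phi> (fst z) (B x (snd z)))"
    by metis
  define F where "F = (\<lambda>x t y. F' x (t, y))"
  have contF: "continuous_on ({a..b} \<times> UNIV) (\<lambda>z. F x (fst z) (snd z))" for x
    using F' by (simp add: F_def)
  have lift: "B (S x) (F x t y) = \<phi> t (B x y)" if "t \<in> {a..b}" for x t y
    using F' that by (simp add: F_def)
  have deg: "monotone_degree_one (F x t)" if t: "t \<in> {a..b}" for x t
  proof (rule oriented_transition_degree_one[OF orientation B_oriented])
    show "\<phi> t \<circ> B x \<in> ori (S x)"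
      using Sk[OF t] B_oriented[of x] by (auto simp: Sk_plus_def)
    show "\<phi> t \<circ> B x = B (S x) \<circ> F x t"
      using lift[OF t] by auto
    have "continuous_on UNIV (\<lambda>y. (\<lambda>z. F x (fst z) (snd z)) (t, y))"
      using t by (intro continuous_on_compose2[OF contF[of x]] continuous_intros) auto
    then show "continuous_on UNIV (F x t)" by simp
  qed
  have equi: "\<exists>d>0. \<forall>x. \<forall>s\<in>{a..b}. \<forall>t\<in>{a..b}. \<forall>y z.
      \<bar>s - t\<bar> < d \<longrightarrow> \<bar>y - z\<bar> < d \<longrightarrow> \<bar>F x s y - F x t z\<bar> < e" if "e > 0" for e
  proof -
    define e' where "e' = min e (1/2)"
    have "e' > 0" using \<open>e > 0\<close> by (simp add: e'_def)
    then obtain d1 where d1: "d1 > 0"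
      and sep: "\<forall>x y z. dist (B x y) (B x z) < d1 \<longrightarrow> (\<exists>m\<in>\<int>. \<bar>y - z - m\<bar> < e')"
      using B_separated by meson
    have "uniformly_continuous_on ({a..b} \<times> UNIV) \<Phi>"
      by (intro compact_uniformly_continuous[OF cont] compact_Times compact_total) auto
    then obtain d2 where d2: "d2 > 0"
      and unif: "\<forall>z\<in>{a..b} \<times> UNIV. \<forall>z'\<in>{a..b} \<times> UNIV. dist z' z < d2 \<longrightarrow> dist (\<Phi> z') (\<Phi> z) < d1"
      unfolding uniformly_continuous_on_def using d1 by meson
    obtain d3 where d3: "d3 > 0" and B_unif: "\<forall>x y z. \<bar>y - z\<bar> < d3 \<longrightarrow> dist (B x y) (B x z) < d2 / 2"
      using B_uniformly_continuous[OF half_gt_zero[OF d2]] by meson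
    define d where "d = min d3 (d2 / 2)"
    have "\<bar>F x s y - F x t z\<bar> < e"
      if st: "s \<in> {a..b}" "t \<in> {a..b}" "\<bar>s - t\<bar> < d" "\<bar>y - z\<bar> < d" for x s t y z
    proof -
      \<comment> \<open>Uniform continuity on the compact total space controls F only modulo
        integers. On the connected rectangle R the integer is constant, and at (t, z) the difference
        is 0, so it vanishes because e' <= 1/2.\<close>
      define R where "R = ({a..b} \<inter> {t - d<..<t + d}) \<times> {z - d<..<z + d}"
      have "d > 0" using d2 d3 by (simp add: d_def)
      have "\<exists>m::int. \<forall>w\<in>R. \<bar>F x (fst w) (snd w) - F x t z - of_int m\<bar> < e'"
      proof (rule connected_near_integers)
        show "connected R"
          unfolding R_def by (intro convex_connected convex_Times convex_Int) auto
        have "R \<subseteq> {a..b} \<times> UNIV" by (auto simp: R_def)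
        then show "continuous_on R (\<lambda>w. F x (fst w) (snd w) - F x t z)"
          by (intro continuous_intros continuous_on_subset[OF contF])
        show "e' \<le> 1/2" by (simp add: e'_def)
        fix w assume w: "w \<in> R"
        have "\<bar>fst w - t\<bar> < d" "\<bar>snd w - z\<bar> < d" and wI: "fst w \<in> {a..b}"
          using w by (auto simp: R_def)
        then have "dist (B x (snd w)) (B x z) < d2 / 2" "dist (fst w) t < d2 / 2"
          using B_unif by (auto simp: d_def dist_real_def)
        then have "dist (fst w, B x (snd w)) (t, B x z) < d2"
          using dist_Pair_le[of "fst w" "B x (snd w)" t "B x z"] by linarith
        then have "dist (\<Phi> (fst w, B x (snd w))) (\<Phi> (t, B x z)) < d1"
          using unif wI st(2) by auto
        then have "dist (B (S x) (F x (fst w) (snd w))) (B (S x) (F x t z)) < d1"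
          using lift wI st(2) by (simp add: \<Phi>_def)
        then show "\<exists>m\<in>\<int>. \<bar>F x (fst w) (snd w) - F x t z - m\<bar> < e'"
          using sep by blast
      qed
      then obtain m :: int where m: "\<forall>w\<in>R. \<bar>F x (fst w) (snd w) - F x t z - of_int m\<bar> < e'" by blast
      have "(t, z) \<in> R" "(s, y) \<in> R" using st \<open>d > 0\<close> by (auto simp: R_def)
      then have *: "\<bar>- real_of_int m\<bar> < e'" "\<bar>F x s y - F x t z - of_int m\<bar> < e'" using m by force+
      then have "m = 0" by (auto simp: e'_def)
      with * show ?thesis by (simp add: e'_def)
    qed
    moreover have "d > 0" using d2 d3 by (simp add: d_def)
    ultimately show ?thesis by blast
  qed
  have "lifts_path S a b \<phi> F"
    unfolding lifts_path_def using contF deg lift equi by blast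
  then show ?thesis by blast
qed

section \<open>Lifts of conjugating maps and their integer defects\<close>

definition lifts_map :: "('e \<Rightarrow> 'e) \<Rightarrow> ('x \<Rightarrow> real \<Rightarrow> real) \<Rightarrow> bool" where
  "lifts_map h H \<longleftrightarrow>
     (\<forall>x. continuous_on UNIV (H x)) \<and> (\<forall>x. monotone_degree_one (H x)) \<and>
     (\<forall>x y. B x (H x y) = h (B x y)) \<and>
     (\<forall>e>0. \<exists>d>0. \<forall>x y z. \<bar>y - z\<bar> < d \<longrightarrow> \<bar>H x y - H x z\<bar> < e)"

lemma lifts_path_continuous_slice:
  assumes "lifts_path S a b \<phi> F" "t \<in> {a..b}"
  shows "continuous_on UNIV (F x t)"
proof -
  have "continuous_on ({a..b} \<times> UNIV) (\<lambda>z. F x (fst z) (snd z))"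
    using assms by (simp add: lifts_path_def)
  then have "continuous_on UNIV (\<lambda>y. (\<lambda>z. F x (fst z) (snd z)) (t, y))"
    by (rule continuous_on_compose2) (use assms(2) in \<open>auto intro!: continuous_intros\<close>)
  then show ?thesis by simp
qed

text \<open>A single map is a constant path over the degenerate interval [0, 0].\<close>

lemma lifts_map_exist:
  assumes "h \<in> Sk_plus p ori id"
  shows "\<exists>H. lifts_map h H"
proof -
  have "Sk_path p ori id 0 0 (\<lambda>_. h)"
    using assms by (simp add: Sk_path_def uniform_limit_const)
  then obtain F where F: "lifts_path id 0 0 (\<lambda>_. h) F" using lifts_path_exist by blast
  have "lifts_map h (\<lambda>x. F x 0)"
    unfolding lifts_map_def
  proof (intro conjI allI impI)
    show "continuous_on UNIV (F x 0)" for x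
      by (rule lifts_path_continuous_slice[OF F]) simp
    fix e :: real assume "e > 0"
    then obtain d where "d > 0" "\<forall>x. \<forall>s\<in>{0..0}. \<forall>t\<in>{0..0}. \<forall>y z.
        \<bar>s - t\<bar> < d \<longrightarrow> \<bar>y - z\<bar> < d \<longrightarrow> \<bar>F x s y - F x t z\<bar> < e"
      using F unfolding lifts_path_def by meson
    then show "\<exists>d>0. \<forall>x y z. \<bar>y - z\<bar> < d \<longrightarrow> \<bar>F x 0 y - F x 0 z\<bar> < e" by auto
  qed (use F in \<open>auto simp: lifts_path_def\<close>)
  then show ?thesis by blast
qed

text \<open>The integer depends on the fiber, since the lifts over different fibers are chosen
  independently.\<close>

lemma close_maps_close_lifts:
  assumes H: "lifts_map h H" "lifts_map h' H'" and "e \<le> 1/2"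
    and sep: "\<forall>x y z. dist (B x y) (B x z) < d \<longrightarrow> (\<exists>m\<in>\<int>. \<bar>y - z - m\<bar> < e)"
    and close: "\<And>u. dist (h u) (h' u) < d"
  shows "\<exists>k::'x \<Rightarrow> int. \<forall>x y. \<bar>H x y - H' x y - of_int (k x)\<bar> < e"
proof -
  have "\<exists>m::int. \<forall>y\<in>UNIV. \<bar>H x y - H' x y - of_int m\<bar> < e" for x
  proof (rule connected_near_integers[OF connected_UNIV _ \<open>e \<le> 1/2\<close>])
    show "continuous_on UNIV (\<lambda>y. H x y - H' x y)"
      using H by (intro continuous_intros) (auto simp: lifts_map_def)
    show "\<exists>m\<in>\<int>. \<bar>H x y - H' x y - m\<bar> < e" for y
      using sep close[of "B x y"] H unfolding lifts_map_def by metis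
  qed
  then show ?thesis by (metis UNIV_I)
qed

text \<open>Both sides lift the same map from the fiber over x to the fiber over T x, so they differ
  by an integer constant along the fiber.\<close>

lemma conjugacy_defect:
  assumes F: "lifts_path T a b \<phi> F" and G: "lifts_path T a b \<psi> G" and t: "t \<in> {a..b}"
    and H: "lifts_map h H" and conj: "h \<circ> \<phi> t = \<psi> t \<circ> h"
  shows "\<exists>m::'x \<Rightarrow> int. \<forall>x y. H (T x) (F x t y) = G x t (H x y) + of_int (m x)"
proof -
  have "\<exists>m::int. \<forall>y. H (T x) (F x t y) = G x t (H x y) + of_int m" for x
  proof (rule circle_cover_lifts_differ_by_integer[OF B_cover[of "T x"] connected_UNIV])
    have contH: "continuous_on UNIV (H z)" for z using H by (simp add: lifts_map_def)
    show "continuous_on UNIV (\<lambda>y. H (T x) (F x t y))"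
      by (rule continuous_on_compose2[OF contH lifts_path_continuous_slice[OF F t]]) simp
    show "continuous_on UNIV (\<lambda>y. G x t (H x y))"
      by (rule continuous_on_compose2[OF lifts_path_continuous_slice[OF G t] contH]) simp
    fix y
    have "B (T x) (H (T x) (F x t y)) = h (\<phi> t (B x y))"
      using F H t by (simp add: lifts_map_def lifts_path_def)
    also have "\<dots> = \<psi> t (h (B x y))" using conj by (metis comp_apply)
    also have "\<dots> = B (T x) (G x t (H x y))"
      using G H t by (simp add: lifts_map_def lifts_path_def)
    finally show "B (T x) (H (T x) (F x t y)) = B (T x) (G x t (H x y))" .
  qed blast
  then show ?thesis by metis
qed

section \<open>A countable code for the conjugating maps\<close>

lemma finite_net:
  assumes "e > 0"
  shows "\<exists>us::'e list. \<forall>v. \<exists>u\<in>set us. dist v u < e"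
proof -
  have "\<exists>k. finite k \<and> (UNIV :: 'e set) \<subseteq> (\<Union>u\<in>k. ball u e)"
    using compact_total assms unfolding compact_eq_totally_bounded by blast
  then obtain k where k: "finite k" "(UNIV :: 'e set) \<subseteq> (\<Union>u\<in>k. ball u e)" by blast
  obtain us where us: "set us = k" using finite_list[OF k(1)] by blast
  have "\<exists>u\<in>set us. dist v u < e" for v
  proof -
    have "\<exists>u\<in>k. v \<in> ball u e" using k(2) by blast
    then show ?thesis using us by (auto simp: dist_commute)
  qed
  then show ?thesis by blast
qed

text \<open>A conjugating map \<open>h\<close> is encoded by a modulus of continuity and by the approximate values
  of \<open>h\<close> on a finite net adapted to that modulus; there are countably many codes, and maps with
  equal codes are uniformly close.\<close>

lemma countable_code_of_maps:
  fixes H :: "real \<Rightarrow> 'x \<Rightarrow> real \<Rightarrow> real"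
  assumes h: "\<And>t. t \<in> A \<Longrightarrow> continuous_on UNIV (h t)"
    and H: "\<And>t. t \<in> A \<Longrightarrow> lifts_map (h t) (H t)"
    and "e > 0" "e' > 0"
  shows "\<exists>(\<mu> :: real \<Rightarrow> nat) (code :: real \<Rightarrow> nat list).
    (\<forall>t\<in>A. \<forall>x y z. \<bar>y - z\<bar> < inverse (Suc (\<mu> t)) \<longrightarrow> \<bar>H t x y - H t x z\<bar> < e') \<and>
    (\<forall>s\<in>A. \<forall>t\<in>A. \<mu> s = \<mu> t \<longrightarrow> code s = code t \<longrightarrow> (\<forall>v. dist (h s v) (h t v) < e))"
proof -
  have "\<exists>m. (\<forall>u v. dist u v < inverse (Suc m) \<longrightarrow> dist (h t u) (h t v) < e / 4) \<and>
      (\<forall>x y z. \<bar>y - z\<bar> < inverse (Suc m) \<longrightarrow> \<bar>H t x y - H t x z\<bar> < e')" if t: "t \<in> A" for t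
  proof -
    have "uniformly_continuous_on UNIV (h t)"
      by (rule compact_uniformly_continuous[OF h[OF t] compact_total])
    moreover have "e / 4 > 0" using \<open>e > 0\<close> by simp
    ultimately obtain d1 where d1: "d1 > 0" "\<forall>u v. dist u v < d1 \<longrightarrow> dist (h t u) (h t v) < e / 4"
      unfolding uniformly_continuous_on_def by blast
    obtain d2 where d2: "d2 > 0" "\<forall>x y z. \<bar>y - z\<bar> < d2 \<longrightarrow> \<bar>H t x y - H t x z\<bar> < e'"
      using H[OF t] \<open>e' > 0\<close> unfolding lifts_map_def by blast
    obtain m where "inverse (real (Suc m)) < min d1 d2"
      using reals_Archimedean[of "min d1 d2"] d1(1) d2(1) by auto
    then show ?thesis using d1(2) d2(2) by (intro exI[of _ m]) simp
  qed
  then have "\<exists>\<mu>. \<forall>t\<in>A. (\<forall>u v. dist u v < inverse (Suc (\<mu> t)) \<longrightarrow> dist (h t u) (h t v) < e / 4) \<and>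
      (\<forall>x y z. \<bar>y - z\<bar> < inverse (Suc (\<mu> t)) \<longrightarrow> \<bar>H t x y - H t x z\<bar> < e')"
    by (intro bchoice ballI)
  then obtain \<mu> where \<mu>: "\<forall>t\<in>A. (\<forall>u v. dist u v < inverse (Suc (\<mu> t)) \<longrightarrow> dist (h t u) (h t v) < e / 4) \<and>
      (\<forall>x y z. \<bar>y - z\<bar> < inverse (Suc (\<mu> t)) \<longrightarrow> \<bar>H t x y - H t x z\<bar> < e')" ..
  have "\<forall>m::nat. \<exists>us::'e list. \<forall>v. \<exists>u\<in>set us. dist v u < inverse (Suc m)"
    by (intro allI finite_net) simp
  then have "\<exists>net. \<forall>m::nat. \<forall>v::'e. \<exists>u\<in>set (net m). dist v u < inverse (Suc m)" by (rule choice)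
  then obtain net where net: "\<forall>m::nat. \<forall>v::'e. \<exists>u\<in>set (net m). dist v u < inverse (Suc m)" ..
  obtain zs where zs: "\<forall>v::'e. \<exists>u\<in>set zs. dist v u < e / 4"
    using finite_net[of "e / 4"] \<open>e > 0\<close> by auto
  \<comment> \<open>An index beyond the end of the list would do no harm: only the distance to
    \<open>zs ! i\<close> is used.\<close>
  define idx where "idx = (\<lambda>v. SOME i. dist v (zs ! i) < e / 4)"
  have idx: "dist v (zs ! idx v) < e / 4" for v
  proof -
    have "\<exists>i. dist v (zs ! i) < e / 4" using zs by (metis in_set_conv_nth)
    then show ?thesis unfolding idx_def by (rule someI_ex)
  qed
  define code where "code = (\<lambda>t. map (\<lambda>u. idx (h t u)) (net (\<mu> t)))"
  have "dist (h s v) (h t v) < e"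
    if st: "s \<in> A" "t \<in> A" "\<mu> s = \<mu> t" "code s = code t" for s t v
  proof -
    \<comment> \<open>Four links of e / 4: from \<open>h s v\<close> to \<open>h s u\<close>, to a
      common point of \<open>zs\<close>, to \<open>h t u\<close>, to \<open>h t v\<close>. Equal
      \<mu> gives s and t the same net and the same modulus.\<close>
    obtain u where u: "u \<in> set (net (\<mu> t))" "dist v u < inverse (Suc (\<mu> t))" using net by blast
    have "idx (h s u) = idx (h t u)" using st(3,4) u(1) by (simp add: code_def)
    then have "dist (h s u) (zs ! idx (h s u)) < e / 4" "dist (h t u) (zs ! idx (h s u)) < e / 4"
      using idx by metis+
    moreover have "dist (h s v) (h s u) < e / 4" "dist (h t v) (h t u) < e / 4"
      using \<mu> st u(2) by metis+
    ultimately show ?thesis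
      using dist_triangle2[of "h s u" "h t u" "zs ! idx (h s u)"]
        dist_triangle[of "h s v" "h t v" "h s u"] dist_triangle2[of "h s u" "h t v" "h t u"]
      by linarith
  qed
  then show ?thesis using \<mu> by (intro exI[of _ \<mu>] exI[of _ code]) blast
qed

section \<open>Agreement of defects within a class\<close>

lemma conjugate_paths_same_displacement:
  assumes "a \<le> b"
    and F: "lifts_path T a b \<phi> F" and G: "lifts_path T a b \<psi> G"
    and coh: "\<forall>t\<in>{a..b}. cohomologous p ori (\<phi> t) (\<psi> t)"
  shows "(\<lambda>n. ((orbit (\<lambda>i. F ((T ^^ i) x)) y b n - orbit (\<lambda>i. F ((T ^^ i) x)) y a n) -
      (orbit (\<lambda>i. G ((T ^^ i) x)) y b n - orbit (\<lambda>i. G ((T ^^ i) x)) y a n)) / real n) \<longlonglongrightarrow> 0"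
proof -
  have "\<exists>h. continuous_on UNIV h \<and> h \<circ> \<phi> t = \<psi> t \<circ> h \<and> (\<exists>H. lifts_map h H)" if "t \<in> {a..b}" for t
    using coh that lifts_map_exist unfolding cohomologous_def Sk_plus_def by blast
  then obtain h where h: "\<And>t. t \<in> {a..b} \<Longrightarrow> continuous_on UNIV (h t)"
    and conj: "\<And>t. t \<in> {a..b} \<Longrightarrow> h t \<circ> \<phi> t = \<psi> t \<circ> h t"
    and ex: "\<And>t. t \<in> {a..b} \<Longrightarrow> \<exists>H. lifts_map (h t) H"
    by metis
  from ex obtain H where H: "\<And>t. t \<in> {a..b} \<Longrightarrow> lifts_map (h t) (H t)" by metis
  have degH: "monotone_degree_one (H t x)" if "t \<in> {a..b}" for t x
    using H[OF that] by (simp add: lifts_map_def)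
  have equiF: "uniformly_equicontinuous {a..b} (\<lambda>i. F ((T ^^ i) x))"
    and degF: "t \<in> {a..b} \<Longrightarrow> monotone_degree_one (F z t)"
    and F8: "\<forall>e>0. \<exists>d>0. \<forall>x. \<forall>s\<in>{a..b}. \<forall>t\<in>{a..b}. \<forall>y z.
        \<bar>s - t\<bar> < d \<longrightarrow> \<bar>y - z\<bar> < d \<longrightarrow> \<bar>F x s y - F x t z\<bar> < e" for t z
    using F unfolding lifts_path_def uniformly_equicontinuous_def by meson+
  have equiG: "uniformly_equicontinuous {a..b} (\<lambda>i. G ((T ^^ i) x))"
    and degG: "t \<in> {a..b} \<Longrightarrow> monotone_degree_one (G z t)"
    and G8: "\<forall>e>0. \<exists>d>0. \<forall>x. \<forall>s\<in>{a..b}. \<forall>t\<in>{a..b}. \<forall>y z.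
        \<bar>s - t\<bar> < d \<longrightarrow> \<bar>y - z\<bar> < d \<longrightarrow> \<bar>G x s y - G x t z\<bar> < e" for t z
    using G unfolding lifts_path_def uniformly_equicontinuous_def by meson+
  obtain dG where dG: "dG > 0" "\<forall>x. \<forall>s\<in>{a..b}. \<forall>t\<in>{a..b}. \<forall>y z.
      \<bar>s - t\<bar> < dG \<longrightarrow> \<bar>y - z\<bar> < dG \<longrightarrow> \<bar>G x s y - G x t z\<bar> < 1/8"
    using G8[rule_format, of "1/8"] by auto
  \<comment> \<open>The bound dG allows G to be compared at the values of two close lifts; 1/8 keeps
    the sum of the three errors in \<open>defect_eq\<close> below 1.\<close>
  define e where "e = min dG (1/8)"
  have e: "e > 0" "e \<le> 1/8" "e \<le> dG" using dG(1) by (auto simp: e_def)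
  obtain d where d: "d > 0" "\<forall>x y z. dist (B x y) (B x z) < d \<longrightarrow> (\<exists>m\<in>\<int>. \<bar>y - z - m\<bar> < e)"
    using B_separated[OF e(1)] by blast
  have "\<exists>(\<mu> :: real \<Rightarrow> nat) (code :: real \<Rightarrow> nat list).
    (\<forall>t\<in>{a..b}. \<forall>x y z. \<bar>y - z\<bar> < inverse (Suc (\<mu> t)) \<longrightarrow> \<bar>H t x y - H t x z\<bar> < 1/8) \<and>
    (\<forall>s\<in>{a..b}. \<forall>t\<in>{a..b}. \<mu> s = \<mu> t \<longrightarrow> code s = code t \<longrightarrow> (\<forall>v. dist (h s v) (h t v) < d))"
    using h H d(1) by (intro countable_code_of_maps) auto
  then obtain \<mu> :: "real \<Rightarrow> nat" and code :: "real \<Rightarrow> nat list"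
    where \<mu>: "\<forall>t\<in>{a..b}. \<forall>x y z. \<bar>y - z\<bar> < inverse (Suc (\<mu> t)) \<longrightarrow> \<bar>H t x y - H t x z\<bar> < 1/8"
      and code: "\<forall>s\<in>{a..b}. \<forall>t\<in>{a..b}. \<mu> s = \<mu> t \<longrightarrow> code s = code t \<longrightarrow> (\<forall>v. dist (h s v) (h t v) < d)"
    by (elim exE conjE)
  \<comment> \<open>How little t may move depends on the modulus of the conjugating lift, which is
    not uniform in t; hence a separate step \<delta> m for each modulus index m.\<close>
  have "\<forall>m::nat. \<exists>d>0. \<forall>x. \<forall>s\<in>{a..b}. \<forall>t\<in>{a..b}. \<forall>y.
      \<bar>s - t\<bar> < d \<longrightarrow> \<bar>F x s y - F x t y\<bar> < inverse (Suc m)"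
  proof
    fix m :: nat
    have "inverse (real (Suc m)) > 0" by simp
    from F8[THEN spec, THEN mp, OF this]
    obtain d where "d > 0" and d: "\<forall>x. \<forall>s\<in>{a..b}. \<forall>t\<in>{a..b}. \<forall>y z.
        \<bar>s - t\<bar> < d \<longrightarrow> \<bar>y - z\<bar> < d \<longrightarrow> \<bar>F x s y - F x t z\<bar> < inverse (Suc m)"
      by (elim exE conjE)
    have "\<bar>F x s y - F x t y\<bar> < inverse (Suc m)"
      if "s \<in> {a..b}" "t \<in> {a..b}" "\<bar>s - t\<bar> < d" for x s t y
      using d[rule_format, OF that, of y y x] \<open>d > 0\<close> by simp
    then show "\<exists>d>0. \<forall>x. \<forall>s\<in>{a..b}. \<forall>t\<in>{a..b}. \<forall>y.
      \<bar>s - t\<bar> < d \<longrightarrow> \<bar>F x s y - F x t y\<bar> < inverse (Suc m)"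
      using \<open>d > 0\<close> by blast
  qed
  then have "\<exists>\<delta>. \<forall>m::nat. \<delta> m > 0 \<and> (\<forall>x. \<forall>s\<in>{a..b}. \<forall>t\<in>{a..b}. \<forall>y.
      \<bar>s - t\<bar> < \<delta> m \<longrightarrow> \<bar>F x s y - F x t y\<bar> < inverse (Suc m))" by (rule choice)
  then obtain \<delta> where \<delta>: "\<forall>m::nat. \<delta> m > 0 \<and> (\<forall>x. \<forall>s\<in>{a..b}. \<forall>t\<in>{a..b}. \<forall>y.
      \<bar>s - t\<bar> < \<delta> m \<longrightarrow> \<bar>F x s y - F x t y\<bar> < inverse (Suc m))" ..
  \<comment> \<open>The integer part places t in a cell of a grid whose mesh depends only on \<mu>
    t. Equal labels thus include the closeness of s and t, and the label type remains
    countable.\<close>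
  define K where "K = (\<lambda>t. (\<mu> t, \<lfloor>t / min (\<delta> (\<mu> t)) dG\<rfloor>, code t))"
  show ?thesis
  proof (rule conjugate_lifts_same_displacement[where K = K, OF \<open>a \<le> b\<close> equiF _ equiG])
    fix s t assume s: "s \<in> {a..b}" and t: "t \<in> {a..b}" and "K s = K t"
    then have \<mu>_eq: "\<mu> s = \<mu> t" and code_eq: "code s = code t"
      and fl: "\<lfloor>s / min (\<delta> (\<mu> s)) dG\<rfloor> = \<lfloor>t / min (\<delta> (\<mu> s)) dG\<rfloor>" by (auto simp: K_def)
    define D where "D = min (\<delta> (\<mu> s)) dG"
    have "D > 0" using \<delta> dG(1) by (simp add: D_def)
    have "\<bar>s / D - t / D\<bar> < 1" using fl unfolding D_def[symmetric] by linarith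
    then have "\<bar>s - t\<bar> < D" using \<open>D > 0\<close> by (simp add: diff_divide_distrib[symmetric] divide_less_eq)
    then have st: "\<bar>s - t\<bar> < \<delta> (\<mu> s)" "\<bar>s - t\<bar> < dG" by (auto simp: D_def)
    have "\<exists>k::'x \<Rightarrow> int. \<forall>x y. \<bar>H s x y - H t x y - of_int (k x)\<bar> < e"
      using code s t \<mu>_eq code_eq e(2) by (intro close_maps_close_lifts[OF H[OF s] H[OF t] _ d(2)]) auto
    then obtain k :: "'x \<Rightarrow> int" where k: "\<And>x y. \<bar>H s x y - H t x y - of_int (k x)\<bar> < e" by blast
    obtain ms :: "'x \<Rightarrow> int" where ms: "\<forall>x y. H s (T x) (F x s y) = G x s (H s x y) + of_int (ms x)"
      using conjugacy_defect[OF F G s H[OF s] conj[OF s]] by blast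
    obtain mt :: "'x \<Rightarrow> int" where mt: "\<forall>x y. H t (T x) (F x t y) = G x t (H t x y) + of_int (mt x)"
      using conjugacy_defect[OF F G t H[OF t] conj[OF t]] by blast
    \<comment> \<open>Shifting the lift of \<open>h t\<close> by k brings it near that of
      \<open>h s\<close> and changes its defect by the coboundary k (T x) - k x.\<close>
    define H' where "H' = (\<lambda>x y. H t x y + of_int (k x))"
    have close: "\<bar>H s x y - H' x y\<bar> < e" for x y
      using k[of x y] by (simp add: H'_def)
    have H'_conj: "H' (T x) (F x t y) = G x t (H' x y) + of_int (mt x + k (T x) - k x)" for x y
      using mt monotone_degree_one_add_int[OF degG[OF t], of x "H t x y" "k x"]
      by (simp add: H'_def)
    \<comment> \<open>Both conjugacy relations at the single point y = 0 determine these integers up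
      to less than 1.\<close>
    have defect_eq: "mt x + k (T x) - k x = ms x" for x
    proof -
      define F0 where "F0 = F x t 0"
      have "\<bar>F x s 0 - F0\<bar> < inverse (Suc (\<mu> s))"
        using \<delta> s t st(1) by (simp add: F0_def)
      then have "\<bar>H s (T x) (F x s 0) - H s (T x) F0\<bar> < 1/8" using \<mu> s by blast
      moreover have "\<bar>H s (T x) F0 - H' (T x) F0\<bar> < 1/8" using close[of "T x" F0] e(2) by linarith
      moreover have "\<bar>G x s (H s x 0) - G x t (H' x 0)\<bar> < 1/8"
        using dG(2) s t st(2) close[of x 0] e(3) by auto
      moreover have "H s (T x) (F x s 0) = G x s (H s x 0) + of_int (ms x)" using ms by blast
      moreover have "H' (T x) F0 = G x t (H' x 0) + of_int (mt x + k (T x) - k x)"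
        unfolding F0_def by (rule H'_conj)
      ultimately have "\<bar>real_of_int (mt x + k (T x) - k x) - of_int (ms x)\<bar> < 1" by linarith
      then show ?thesis by linarith
    qed
    have degH': "monotone_degree_one (H' x)" for x
      using degH[OF t, of x] by (auto simp: H'_def monotone_degree_one_def mono_def)
    show "\<exists>Ha Hb m. (\<forall>i. monotone_degree_one (Ha i) \<and> monotone_degree_one (Hb i)) \<and>
        (\<forall>i y. \<bar>Ha i y - Hb i y\<bar> \<le> 1) \<and>
        (\<forall>i y. Ha (Suc i) (F ((T ^^ i) x) s y) = G ((T ^^ i) x) s (Ha i y) + real_of_int (m i)) \<and>
        (\<forall>i y. Hb (Suc i) (F ((T ^^ i) x) t y) = G ((T ^^ i) x) t (Hb i y) + real_of_int (m i))"
    proof (intro exI conjI allI)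
      fix i y
      show "monotone_degree_one (H s ((T ^^ i) x))" "monotone_degree_one (H' ((T ^^ i) x))"
        by (rule degH[OF s], rule degH')
      show "\<bar>H s ((T ^^ i) x) y - H' ((T ^^ i) x) y\<bar> \<le> 1"
        using close[of "(T ^^ i) x" y] e(2) by linarith
      show "H s ((T ^^ Suc i) x) (F ((T ^^ i) x) s y)
          = G ((T ^^ i) x) s (H s ((T ^^ i) x) y) + of_int (ms ((T ^^ i) x))"
        using ms by simp
      show "H' ((T ^^ Suc i) x) (F ((T ^^ i) x) t y)
          = G ((T ^^ i) x) t (H' ((T ^^ i) x) y) + of_int (ms ((T ^^ i) x))"
        using H'_conj unfolding defect_eq by simp
    qed
  qed (use degF degG in auto)
qed

section \<open>From lifted displacements to rotation numbers\<close>

lemma B_orbit: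
  assumes F: "lifts_path T a b \<phi> F" and "t \<in> {a..b}"
  shows "B ((T ^^ n) x) (orbit (\<lambda>i. F ((T ^^ i) x)) y t n) = (\<phi> t ^^ n) (B x y)"
  using assms by (induction n) (auto simp: lifts_path_def)

lemma continuous_on_orbit:
  assumes F: "lifts_path T a b \<phi> F"
  shows "continuous_on {a..b} (\<lambda>t. orbit (\<lambda>i. F ((T ^^ i) x)) y t n)"
proof (induction n)
  case (Suc n)
  have "continuous_on ({a..b} \<times> UNIV) (\<lambda>z. F ((T ^^ n) x) (fst z) (snd z))"
    using F by (simp add: lifts_path_def)
  then have "continuous_on {a..b} (\<lambda>t. (\<lambda>z. F ((T ^^ n) x) (fst z) (snd z))
      (t, orbit (\<lambda>i. F ((T ^^ i) x)) y t n))"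
    by (rule continuous_on_compose2) (use Suc in \<open>auto intro!: continuous_intros\<close>)
  then show ?case by simp
qed simp

lemma path_winding_orbit_approx:
  assumes F: "lifts_path T a b \<phi> F" and "a \<le> b" and unit: "unit_length_fibers ori"
  shows "\<bar>path_winding p ori a b (\<lambda>t. (\<phi> t ^^ n) (B x y)) -
    (orbit (\<lambda>i. F ((T ^^ i) x)) y b n - orbit (\<lambda>i. F ((T ^^ i) x)) y a n)\<bar> \<le> 2"
proof (rule path_winding_approx[where ori = ori and x = "(T ^^ n) x", OF orientation _ _ \<open>a \<le> b\<close> B_oriented])
  show "curve_length c 0 1 = 1" if "c \<in> ori ((T ^^ n) x)" for c
    using unit that by (auto simp: unit_length_fibers_def)
  show lift: "B ((T ^^ n) x) (orbit (\<lambda>i. F ((T ^^ i) x)) y t n) = (\<phi> t ^^ n) (B x y)"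
    if "t \<in> {a..b}" for t
    by (rule B_orbit[OF F that])
  show "p ((\<phi> a ^^ n) (B x y)) = (T ^^ n) x"
    using lift[of a] \<open>a \<le> b\<close> p_B by (metis atLeastAtMost_iff order_refl)
  show "continuous_on {a..b} (\<lambda>t. orbit (\<lambda>i. F ((T ^^ i) x)) y t n)"
    by (rule continuous_on_orbit[OF F])
qed

text \<open>Each winding number is within 2 of a lifted displacement, an error that disappears after
  division by n. Equality as predicates in r transfers existence and value together.\<close>

lemma has_rotation_number_iff:
  assumes "a \<le> b" "unit_length_fibers ori" "Sk_path p ori T a b \<phi>" "Sk_path p ori T a b \<psi>"
    and coh: "\<forall>t\<in>{a..b}. cohomologous p ori (\<phi> t) (\<psi> t)"
  shows "has_rotation_number p ori a b \<phi> x = has_rotation_number p ori a b \<psi> x"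
proof
  fix r
  obtain F where F: "lifts_path T a b \<phi> F" using lifts_path_exist[OF assms(3)] by blast
  obtain G where G: "lifts_path T a b \<psi> G" using lifts_path_exist[OF assms(4)] by blast
  have "(\<lambda>n. path_winding p ori a b (\<lambda>t. (\<phi> t ^^ n) u) / real n) \<longlonglongrightarrow> r \<longleftrightarrow>
      (\<lambda>n. path_winding p ori a b (\<lambda>t. (\<psi> t ^^ n) u) / real n) \<longlonglongrightarrow> r" if u: "u \<in> fiber p x" for u
  proof -
    obtain y where y: "u = B x y" using B_surj u by auto
    define WF WG where "WF = (\<lambda>n. path_winding p ori a b (\<lambda>t. (\<phi> t ^^ n) u))"
      and "WG = (\<lambda>n. path_winding p ori a b (\<lambda>t. (\<psi> t ^^ n) u))"
    define \<Gamma>F \<Gamma>G where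
      "\<Gamma>F = (\<lambda>n. orbit (\<lambda>i. F ((T ^^ i) x)) y b n - orbit (\<lambda>i. F ((T ^^ i) x)) y a n)"
      and "\<Gamma>G = (\<lambda>n. orbit (\<lambda>i. G ((T ^^ i) x)) y b n - orbit (\<lambda>i. G ((T ^^ i) x)) y a n)"
    have approx: "\<bar>WF n - \<Gamma>F n\<bar> \<le> 2" "\<bar>WG n - \<Gamma>G n\<bar> \<le> 2" for n
      unfolding WF_def WG_def \<Gamma>F_def \<Gamma>G_def y
      using path_winding_orbit_approx[OF F \<open>a \<le> b\<close> assms(2)]
        path_winding_orbit_approx[OF G \<open>a \<le> b\<close> assms(2)] by blast+
    have "(\<lambda>n. (\<Gamma>F n - \<Gamma>G n) / real n) \<longlonglongrightarrow> 0"
      unfolding \<Gamma>F_def \<Gamma>G_def by (rule conjugate_paths_same_displacement[OF \<open>a \<le> b\<close> F G coh])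
    moreover have "(\<lambda>n. ((WF n - WG n) - (\<Gamma>F n - \<Gamma>G n)) / real n) \<longlonglongrightarrow> 0"
    proof (rule Lim_null_comparison)
      show "\<forall>\<^sub>F n in sequentially. norm (((WF n - WG n) - (\<Gamma>F n - \<Gamma>G n)) / real n) \<le> 4 / real n"
      proof (rule always_eventually, rule allI)
        fix n
        have "\<bar>(WF n - WG n) - (\<Gamma>F n - \<Gamma>G n)\<bar> \<le> 4" using approx[of n] by linarith
        then show "norm (((WF n - WG n) - (\<Gamma>F n - \<Gamma>G n)) / real n) \<le> 4 / real n"
          by (simp add: divide_right_mono)
      qed
      show "(\<lambda>n. 4 / real n) \<longlonglongrightarrow> 0" by (rule lim_const_over_n)
    qed
    ultimately have "(\<lambda>n. (\<Gamma>F n - \<Gamma>G n) / real n + ((WF n - WG n) - (\<Gamma>F n - \<Gamma>G n)) / real n)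
        \<longlonglongrightarrow> 0 + 0" by (rule tendsto_add)
    then have diff: "(\<lambda>n. WF n / real n - WG n / real n) \<longlonglongrightarrow> 0"
      by (simp add: add_divide_distrib[symmetric] diff_divide_distrib[symmetric])
    have "(\<lambda>n. WF n / real n) \<longlonglongrightarrow> r \<longleftrightarrow> (\<lambda>n. WG n / real n) \<longlonglongrightarrow> r"
      using tendsto_diff[OF _ diff, of "\<lambda>n. WF n / real n" r] tendsto_add[OF diff, of "\<lambda>n. WG n / real n" r]
      by auto
    then show ?thesis by (simp add: WF_def WG_def)
  qed
  then show "has_rotation_number p ori a b \<phi> x r = has_rotation_number p ori a b \<psi> x r"
    unfolding has_rotation_number_def by blast
qed

end

theorem proposition3p5:
  fixes T :: "'x::metric_space \<Rightarrow> 'x"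
    and p :: "'e::metric_space \<Rightarrow> 'x"
    and ori :: "'x \<Rightarrow> (real \<Rightarrow> 'e) set"
    and \<phi> \<psi> :: "real \<Rightarrow> 'e \<Rightarrow> 'e"
    and a b :: real
  assumes "compact (UNIV :: 'x set)"
    and "continuous_on UNIV T"
    and "oriented_circle_bundle p ori"
    and "unit_length_fibers ori"
    and "a \<le> b"
    and "Sk_path p ori T a b \<phi>"
    and "Sk_path p ori T a b \<psi>"
    and "\<forall>t\<in>{a..b}. cohomologous p ori (\<phi> t) (\<psi> t)"
  shows "\<forall>x. (\<exists>r. has_rotation_number p ori a b \<phi> x r) \<or>
             (\<exists>r. has_rotation_number p ori a b \<psi> x r) \<longrightarrow>
             (\<exists>r. has_rotation_number p ori a b \<phi> x r) \<and>
             (\<exists>r. has_rotation_number p ori a b \<psi> x r) \<and>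
             rotation_number p ori a b \<phi> x = rotation_number p ori a b \<psi> x"
proof -
  obtain B \<kappa> where "uniform_fiber_covers p ori B \<kappa>"
    using uniform_fiber_covers_exist[OF assms(1,3)] by blast
  then interpret uniform_fiber_covers p ori B \<kappa> .
  have "has_rotation_number p ori a b \<phi> x = has_rotation_number p ori a b \<psi> x" for x
    using assms by (intro has_rotation_number_iff)
  then show ?thesis by (simp add: rotation_number_def)
qed

end
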